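(* For any $1<p<\infty$, a typical $T\in(\mathcal B_1(\ell_p),\mathrm{SOT}^* )$ has a non-trivial invariant closed cone.
   Context: $\ell_p$ is the complex sequence space, and $\mathcal B_1(\ell_p)$ is the set of all bounded linear operators $T$ on $\ell_p$ with $\|T\|\le 1$. $\mathrm{SOT}^*$ (Strong$^*$ Operator Topology) is the topology of pointwise norm convergence of operators and of their adjoints: $T_i\to T$ iff $T_ix\to Tx$ for all $x\in \ell_p$ and $T_i^*x^*\to T^*x^*$ for all $x^*\in \ell_p^*$, in norm; $(\mathcal B_1(\ell_p),\mathrm{SOT}^* )$ is a Polish space. "A typical $T$ satisfies (P)" means that the set of $T\in\mathcal B_1(\ell_p)$ satisfying (P) is comeager in $(\mathcal B_1(\ell_p),\mathrm{SOT}^* )$. A non-trivial invariant closed cone for $T$ is a non-empty closed set $C\subseteq \ell_p$ with $tC\subseteq C$ for all $t\ge0$, $C\ne\{0\}$, $C\neq \ell_p$, and $T(C)\subseteq C$. *)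

theory Defs
  imports "HOL-Analysis.Analysis" "HOL-Library.FuncSet"
begin

text \<open>The exponent \<open>p\<close> is a real variable, so the sequence space is a set of sequences rather than a type.\<close>

definition lp :: "real \<Rightarrow> (nat \<Rightarrow> complex) set" where
  "lp p = {x. summable (\<lambda>n. norm (x n) powr p)}"

definition lp_norm :: "real \<Rightarrow> (nat \<Rightarrow> complex) \<Rightarrow> real" where
  "lp_norm p x = (\<Sum>n. norm (x n) powr p) powr (1 / p)"

definition lp_dist :: "real \<Rightarrow> (nat \<Rightarrow> complex) \<Rightarrow> (nat \<Rightarrow> complex) \<Rightarrow> real" where
  "lp_dist p x y = lp_norm p (\<lambda>n. x n - y n)"

definition lp_topology :: "real \<Rightarrow> (nat \<Rightarrow> complex) topology" where
  "lp_topology p = Metric_space.mtopology (lp p) (lp_dist p)"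

text \<open>
  Operators and functionals are maps on \<open>lp p\<close> only; they are made \<open>extensional\<close> (equal to
  \<open>undefined\<close> off \<open>lp p\<close>) so that equality of HOL functions is equality of operators.
\<close>

definition lp_operators :: "real \<Rightarrow> ((nat \<Rightarrow> complex) \<Rightarrow> (nat \<Rightarrow> complex)) set" where
  "lp_operators p = {T \<in> lp p \<rightarrow>\<^sub>E lp p.
     (\<forall>x\<in>lp p. \<forall>y\<in>lp p. T (\<lambda>n. x n + y n) = (\<lambda>n. T x n + T y n)) \<and>
     (\<forall>c. \<forall>x\<in>lp p. T (\<lambda>n. c * x n) = (\<lambda>n. c * T x n)) \<and>
     (\<exists>K. \<forall>x\<in>lp p. lp_norm p (T x) \<le> K * lp_norm p x)}"

definition lp_opnorm :: "real \<Rightarrow> ((nat \<Rightarrow> complex) \<Rightarrow> (nat \<Rightarrow> complex)) \<Rightarrow> real" where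
  "lp_opnorm p T = (SUP x\<in>{x \<in> lp p. lp_norm p x \<le> 1}. lp_norm p (T x))"

definition lp_unit_operators :: "real \<Rightarrow> ((nat \<Rightarrow> complex) \<Rightarrow> (nat \<Rightarrow> complex)) set" where
  "lp_unit_operators p = {T \<in> lp_operators p. lp_opnorm p T \<le> 1}"

definition lp_dual :: "real \<Rightarrow> ((nat \<Rightarrow> complex) \<Rightarrow> complex) set" where
  "lp_dual p = {f \<in> extensional (lp p).
     (\<forall>x\<in>lp p. \<forall>y\<in>lp p. f (\<lambda>n. x n + y n) = f x + f y) \<and>
     (\<forall>c. \<forall>x\<in>lp p. f (\<lambda>n. c * x n) = c * f x) \<and>
     (\<exists>K. \<forall>x\<in>lp p. norm (f x) \<le> K * lp_norm p x)}"

definition lp_dual_norm :: "real \<Rightarrow> ((nat \<Rightarrow> complex) \<Rightarrow> complex) \<Rightarrow> real" where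
  "lp_dual_norm p f = (SUP x\<in>{x \<in> lp p. lp_norm p x \<le> 1}. norm (f x))"

text \<open>
  The value off the dual is irrelevant, but \<open>Metric_space\<close> wants a total nonnegative function and
  a real supremum over an unbounded set is unspecified.
\<close>

definition lp_dual_dist :: "real \<Rightarrow> ((nat \<Rightarrow> complex) \<Rightarrow> complex) \<Rightarrow> ((nat \<Rightarrow> complex) \<Rightarrow> complex) \<Rightarrow> real" where
  "lp_dual_dist p f g =
     (if f \<in> lp_dual p \<and> g \<in> lp_dual p then lp_dual_norm p (\<lambda>x. f x - g x) else 0)"

definition lp_dual_topology :: "real \<Rightarrow> ((nat \<Rightarrow> complex) \<Rightarrow> complex) topology" where
  "lp_dual_topology p = Metric_space.mtopology (lp_dual p) (lp_dual_dist p)"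

definition lp_adjoint ::
  "real \<Rightarrow> ((nat \<Rightarrow> complex) \<Rightarrow> (nat \<Rightarrow> complex)) \<Rightarrow> ((nat \<Rightarrow> complex) \<Rightarrow> complex) \<Rightarrow> ((nat \<Rightarrow> complex) \<Rightarrow> complex)"
  where "lp_adjoint p T f = (\<lambda>x\<in>lp p. f (T x))"

text \<open>
  The initial topology for the maps sending \<open>T\<close> to \<open>T x\<close> and to \<open>lp_adjoint p T f\<close>; the
  description by convergence is lemma \<open>limitin_sot_star\<close> below.
\<close>

definition sot_star :: "real \<Rightarrow> ((nat \<Rightarrow> complex) \<Rightarrow> (nat \<Rightarrow> complex)) topology" where
  "sot_star p = pullback_topology (lp_unit_operators p)
     (\<lambda>T. (T, \<lambda>f\<in>lp_dual p. lp_adjoint p T f))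
     (prod_topology (product_topology (\<lambda>_. lp_topology p) (lp p))
                    (product_topology (\<lambda>_. lp_dual_topology p) (lp_dual p)))"

definition nowhere_dense_in :: "'a topology \<Rightarrow> 'a set \<Rightarrow> bool" where
  "nowhere_dense_in X N \<longleftrightarrow> N \<subseteq> topspace X \<and> X interior_of (X closure_of N) = {}"

definition meager_in :: "'a topology \<Rightarrow> 'a set \<Rightarrow> bool" where
  "meager_in X M \<longleftrightarrow> (\<exists>\<N>. countable \<N> \<and> (\<forall>N\<in>\<N>. nowhere_dense_in X N) \<and> M = \<Union>\<N>)"

definition comeager_in :: "'a topology \<Rightarrow> 'a set \<Rightarrow> bool" where
  "comeager_in X S \<longleftrightarrow> S \<subseteq> topspace X \<and> meager_in X (topspace X - S)"

text \<open>Cones are not required to be convex.\<close>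

definition nontrivial_invariant_closed_cone ::
  "real \<Rightarrow> ((nat \<Rightarrow> complex) \<Rightarrow> (nat \<Rightarrow> complex)) \<Rightarrow> (nat \<Rightarrow> complex) set \<Rightarrow> bool" where
  "nontrivial_invariant_closed_cone p T C \<longleftrightarrow>
     C \<noteq> {} \<and> closedin (lp_topology p) C \<and>
     (\<forall>t\<ge>0. \<forall>x\<in>C. (\<lambda>n. complex_of_real t * x n) \<in> C) \<and>
     C \<noteq> {\<lambda>n. 0} \<and> C \<noteq> lp p \<and> T ` C \<subseteq> C"

lemma powr_convex_combination:
  fixes p t u l :: real
  assumes p: "1 \<le> p" and t: "0 \<le> t" and u: "0 \<le> u" and l: "0 < l" "l < 1"
  shows "((1 - l) * t + l * u) powr p \<le> (1 - l) * t powr p + l * u powr p"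
proof -
  have aux: "(m * v) powr p \<le> m * v powr p" if "0 < m" "m < 1" "0 \<le> v" for m v :: real
  proof -
    have "m powr p \<le> m powr 1"
      using that p by (intro powr_mono') auto
    then show ?thesis
      using that by (simp add: powr_mult mult_right_mono)
  qed
  consider "t = 0" | "u = 0" | "t > 0" "u > 0" using t u by linarith
  then show ?thesis
  proof cases
    case 3
    have "convex_on {0<..} (\<lambda>x::real. x powr p)" by (rule powr_convex[OF p])
    from convex_onD[OF this, of l t u] 3 l show ?thesis by simp
  qed (use aux[of l u] aux[of "1 - l" t] l t u p in auto)
qed

lemma lp_zero [simp]: "(\<lambda>n. 0) \<in> lp p"
  by (simp add: lp_def)

lemma lp_norm_zero [simp]: "lp_norm p (\<lambda>n. 0) = 0"
  by (simp add: lp_norm_def)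

lemma lp_norm_nonneg [simp]: "0 \<le> lp_norm p x"
  by (simp add: lp_norm_def)

lemma lp_norm_powr:
  assumes "x \<in> lp p" "0 < p"
  shows "lp_norm p x powr p = (\<Sum>n. norm (x n) powr p)"
  using assms by (simp add: lp_norm_def lp_def powr_powr suminf_nonneg)

lemma lp_norm_eq_0:
  assumes "x \<in> lp p" "0 < p"
  shows "lp_norm p x = 0 \<longleftrightarrow> x = (\<lambda>n. 0)"
proof
  assume "lp_norm p x = 0"
  then have "(\<Sum>n. norm (x n) powr p) = 0"
    using lp_norm_powr[OF assms] assms by simp
  moreover have "summable (\<lambda>n. norm (x n) powr p)" using assms by (simp add: lp_def)
  ultimately show "x = (\<lambda>n. 0)"
    using suminf_eq_zero_iff[of "\<lambda>n. norm (x n) powr p"] by auto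
qed simp

lemma lp_scale:
  assumes "x \<in> lp p"
  shows "(\<lambda>n. c * x n) \<in> lp p"
  using assms by (auto simp: lp_def norm_mult powr_mult intro: summable_mult)

lemma lp_norm_scale:
  assumes "x \<in> lp p" "0 < p"
  shows "lp_norm p (\<lambda>n. c * x n) = norm c * lp_norm p x"
proof -
  have "(\<Sum>n. norm (c * x n) powr p) = norm c powr p * (\<Sum>n. norm (x n) powr p)"
    using assms by (simp add: lp_def norm_mult powr_mult suminf_mult)
  moreover have "0 \<le> (\<Sum>n. norm (x n) powr p)"
    using assms by (simp add: lp_def suminf_nonneg)
  ultimately show ?thesis
    using assms by (simp add: lp_norm_def powr_mult powr_powr)
qed

text \<open>Minkowski's inequality\<close>

lemma lp_add:
  assumes p: "1 \<le> p" and x: "x \<in> lp p" and y: "y \<in> lp p"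
  shows "(\<lambda>n. x n + y n) \<in> lp p"
    and "lp_norm p (\<lambda>n. x n + y n) \<le> lp_norm p x + lp_norm p y"
proof -
  have *: "(\<lambda>n. x n + y n) \<in> lp p \<and> lp_norm p (\<lambda>n. x n + y n) \<le> lp_norm p x + lp_norm p y"
  proof (cases "lp_norm p x = 0 \<or> lp_norm p y = 0")
    case True
    then show ?thesis
      using lp_norm_eq_0[OF x] lp_norm_eq_0[OF y] x y p by auto
  next
    case False
    define a b where "a = lp_norm p x" and "b = lp_norm p y"
    have ab: "a > 0" "b > 0"
      using False by (auto simp: a_def b_def less_le)
    define l where "l = b / (a + b)"
    have l: "0 < l" "l < 1" "1 - l = a / (a + b)"
      using ab by (auto simp: l_def field_simps)
    define h where "h = (\<lambda>n. (1 - l) * (norm (x n) / a) powr p + l * (norm (y n) / b) powr p)"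
    have sx: "summable (\<lambda>n. norm (x n) powr p)" and sy: "summable (\<lambda>n. norm (y n) powr p)"
      using x y by (auto simp: lp_def)
    have sx': "(\<lambda>n. (norm (x n) / a) powr p) sums 1"
    proof -
      have "(\<lambda>n. norm (x n) powr p / a powr p) sums ((\<Sum>n. norm (x n) powr p) / a powr p)"
        by (intro sums_divide summable_sums sx)
      then show ?thesis
        using ab lp_norm_powr[OF x, symmetric] p by (simp add: powr_divide flip: a_def)
    qed
    have sy': "(\<lambda>n. (norm (y n) / b) powr p) sums 1"
    proof -
      have "(\<lambda>n. norm (y n) powr p / b powr p) sums ((\<Sum>n. norm (y n) powr p) / b powr p)"
        by (intro sums_divide summable_sums sy)
      then show ?thesis
        using ab lp_norm_powr[OF y, symmetric] p by (simp add: powr_divide flip: b_def)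
    qed
    have "h sums ((1 - l) * 1 + l * 1)"
      unfolding h_def by (intro sums_add sums_mult sx' sy')
    then have h: "(\<lambda>n. (a + b) powr p * h n) sums ((a + b) powr p)"
      using sums_mult[of h 1 "(a + b) powr p"] by simp
    have le: "norm (x n + y n) powr p \<le> (a + b) powr p * h n" for n
    proof -
      have "norm (x n + y n) \<le> norm (x n) + norm (y n)" by (rule norm_triangle_ineq)
      also have "\<dots> = (a + b) * ((1 - l) * (norm (x n) / a) + l * (norm (y n) / b))"
      proof -
        have "(a + b) * (1 - l) = a" "(a + b) * l = b"
          using ab unfolding l(3) unfolding l_def by auto
        then have "(a + b) * (1 - l) * (norm (x n) / a) + (a + b) * l * (norm (y n) / b) = norm (x n) + norm (y n)"
          using ab by simp
        then show ?thesis by (simp only: distrib_left mult.assoc)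
      qed
      finally have "norm (x n + y n) powr p
          \<le> ((a + b) * ((1 - l) * (norm (x n) / a) + l * (norm (y n) / b))) powr p"
        using p by (intro powr_mono2) auto
      also have "\<dots> = (a + b) powr p * ((1 - l) * (norm (x n) / a) + l * (norm (y n) / b)) powr p"
        using ab l by (intro powr_mult)
      also have "\<dots> \<le> (a + b) powr p * h n"
        unfolding h_def using ab l p by (intro mult_left_mono powr_convex_combination) auto
      finally show ?thesis .
    qed
    have mem: "summable (\<lambda>n. norm (x n + y n) powr p)"
      by (rule summable_comparison_test'[OF sums_summable[OF h], of 0]) (use le in auto)
    have "(\<Sum>n. norm (x n + y n) powr p) \<le> (a + b) powr p"
      using suminf_le[OF le mem sums_summable[OF h]] sums_unique[OF h] by simp
    then have "lp_norm p (\<lambda>n. x n + y n) \<le> ((a + b) powr p) powr (1 / p)"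
      unfolding lp_norm_def using p mem by (intro powr_mono2 suminf_nonneg) auto
    then show ?thesis
      using mem p ab by (simp add: lp_def powr_powr a_def b_def)
  qed
  show "(\<lambda>n. x n + y n) \<in> lp p" "lp_norm p (\<lambda>n. x n + y n) \<le> lp_norm p x + lp_norm p y"
    using * by auto
qed

lemma lp_diff:
  assumes "1 \<le> p" "x \<in> lp p" "y \<in> lp p"
  shows "(\<lambda>n. x n - y n) \<in> lp p"
  using lp_add(1)[OF assms(1,2) lp_scale[OF assms(3), of "-1"]] by simp

lemma Metric_space_lp:
  assumes p: "1 \<le> p"
  shows "Metric_space (lp p) (lp_dist p)"
proof
  show "0 \<le> lp_dist p x y" for x y by (simp add: lp_dist_def)
  show "lp_dist p x y = lp_dist p y x" for x y
    by (simp add: lp_dist_def lp_norm_def norm_minus_commute)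
  fix x y assume xy: "x \<in> lp p" "y \<in> lp p"
  show "lp_dist p x y = 0 \<longleftrightarrow> x = y"
    using lp_norm_eq_0[OF lp_diff[OF p xy]] p by (auto simp: lp_dist_def fun_eq_iff)
  fix z assume z: "z \<in> lp p"
  show "lp_dist p x z \<le> lp_dist p x y + lp_dist p y z"
    using lp_add(2)[OF p lp_diff[OF p xy] lp_diff[OF p xy(2) z]] by (simp add: lp_dist_def)
qed

lemma lp_dual_diff_bound:
  assumes "f \<in> lp_dual p" "g \<in> lp_dual p"
  shows "\<exists>K. \<forall>x\<in>lp p. norm (f x - g x) \<le> K * lp_norm p x"
proof -
  obtain K L where "\<forall>x\<in>lp p. norm (f x) \<le> K * lp_norm p x" "\<forall>x\<in>lp p. norm (g x) \<le> L * lp_norm p x"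
    using assms by (auto simp: lp_dual_def)
  then have "\<forall>x\<in>lp p. norm (f x - g x) \<le> (K + L) * lp_norm p x"
    by (smt (verit) distrib_right norm_triangle_ineq4)
  then show ?thesis by blast
qed

lemma lp_dual_diff_bdd:
  assumes "f \<in> lp_dual p" "g \<in> lp_dual p"
  shows "bdd_above ((\<lambda>x. norm (f x - g x)) ` {x \<in> lp p. lp_norm p x \<le> 1})"
proof -
  obtain K where K: "\<forall>x\<in>lp p. norm (f x - g x) \<le> K * lp_norm p x"
    using lp_dual_diff_bound[OF assms] by blast
  have "norm (f x - g x) \<le> \<bar>K\<bar>" if "x \<in> lp p" "lp_norm p x \<le> 1" for x
  proof -
    have "norm (f x - g x) \<le> K * lp_norm p x" using K that by blast
    also have "\<dots> \<le> \<bar>K\<bar> * 1" using that by (intro mult_mono) auto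
    finally show ?thesis by simp
  qed
  then show ?thesis by (auto intro!: bdd_aboveI[where M = "\<bar>K\<bar>"])
qed

lemma lp_dual_dist_upper:
  assumes "f \<in> lp_dual p" "g \<in> lp_dual p" "x \<in> lp p" "lp_norm p x \<le> 1"
  shows "norm (f x - g x) \<le> lp_dual_dist p f g"
  using cSUP_upper[OF _ lp_dual_diff_bdd[OF assms(1,2)], of x] assms
  by (simp add: lp_dual_dist_def lp_dual_norm_def)

lemma lp_dual_dist_least:
  assumes "f \<in> lp_dual p" "g \<in> lp_dual p"
    and "\<And>x. x \<in> lp p \<Longrightarrow> lp_norm p x \<le> 1 \<Longrightarrow> norm (f x - g x) \<le> K"
  shows "lp_dual_dist p f g \<le> K"
proof -
  have "(\<lambda>n. 0) \<in> {x \<in> lp p. lp_norm p x \<le> 1}" by simp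
  then have "(SUP x\<in>{x \<in> lp p. lp_norm p x \<le> 1}. norm (f x - g x)) \<le> K"
    using assms(3) by (intro cSUP_least) blast+
  then show ?thesis
    using assms(1,2) by (simp add: lp_dual_dist_def lp_dual_norm_def)
qed

lemma Metric_space_lp_dual:
  assumes p: "1 \<le> p"
  shows "Metric_space (lp_dual p) (lp_dual_dist p)"
proof
  show "0 \<le> lp_dual_dist p f g" for f g
  proof (cases "f \<in> lp_dual p \<and> g \<in> lp_dual p")
    case True
    have "0 \<le> norm (f (\<lambda>n. 0) - g (\<lambda>n. 0))" by simp
    also have "\<dots> \<le> lp_dual_dist p f g"
      using True by (intro lp_dual_dist_upper) auto
    finally show ?thesis .
  next
    case False
    then show ?thesis by (auto simp: lp_dual_dist_def)
  qed
  show "lp_dual_dist p f g = lp_dual_dist p g f" for f g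
    by (simp add: lp_dual_dist_def lp_dual_norm_def norm_minus_commute)
  fix f g assume fg: "f \<in> lp_dual p" "g \<in> lp_dual p"
  show "lp_dual_dist p f g = 0 \<longleftrightarrow> f = g"
  proof
    assume 0: "lp_dual_dist p f g = 0"
    have "f x = g x" if x: "x \<in> lp p" for x
    proof (cases "lp_norm p x = 0")
      case True
      then show ?thesis
        using lp_dual_dist_upper[OF fg x] 0 by simp
    next
      case False
      define c where "c = complex_of_real (1 / lp_norm p x)"
      have c: "c \<noteq> 0" "lp_norm p (\<lambda>n. c * x n) = 1"
        using False lp_norm_scale[OF x, of c] p by (auto simp: c_def norm_divide)
      have "norm (f (\<lambda>n. c * x n) - g (\<lambda>n. c * x n)) \<le> 0"
        using lp_dual_dist_upper[OF fg lp_scale[OF x], of c] c 0 by simp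
      moreover have "f (\<lambda>n. c * x n) = c * f x" "g (\<lambda>n. c * x n) = c * g x"
        using fg x by (auto simp: lp_dual_def)
      ultimately show ?thesis using c by simp
    qed
    then show "f = g"
      using fg by (intro extensionalityI[of f "lp p" g]) (auto simp: lp_dual_def)
  next
    assume "f = g"
    have "(\<lambda>n. 0) \<in> {x \<in> lp p. lp_norm p x \<le> 1}" by simp
    then have "{x \<in> lp p. lp_norm p x \<le> 1} \<noteq> {}" by blast
    then show "lp_dual_dist p f g = 0"
      by (simp add: \<open>f = g\<close> lp_dual_dist_def lp_dual_norm_def)
  qed
  fix h assume h: "h \<in> lp_dual p"
  show "lp_dual_dist p f h \<le> lp_dual_dist p f g + lp_dual_dist p g h"
  proof (rule lp_dual_dist_least[OF fg(1) h])
    fix x assume x: "x \<in> lp p" "lp_norm p x \<le> 1"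
    show "norm (f x - h x) \<le> lp_dual_dist p f g + lp_dual_dist p g h"
      using lp_dual_dist_upper[OF fg x] lp_dual_dist_upper[OF fg(2) h x]
        norm_triangle_ineq[of "f x - g x" "g x - h x"] by simp
  qed
qed

lemma lp_adjoint_in_dual:
  assumes p: "1 \<le> p" and T: "T \<in> lp_operators p" and f: "f \<in> lp_dual p"
  shows "lp_adjoint p T f \<in> lp_dual p"
proof -
  obtain K where K: "\<forall>x\<in>lp p. lp_norm p (T x) \<le> K * lp_norm p x"
    using T by (auto simp: lp_operators_def)
  obtain L where L: "\<forall>x\<in>lp p. norm (f x) \<le> L * lp_norm p x"
    using f by (auto simp: lp_dual_def)
  have mem: "T x \<in> lp p" if "x \<in> lp p" for x
    using T that by (auto simp: lp_operators_def)
  have "norm (f (T x)) \<le> (\<bar>L\<bar> * K) * lp_norm p x" if "x \<in> lp p" for x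
  proof -
    have "norm (f (T x)) \<le> L * lp_norm p (T x)" using L mem[OF that] by blast
    also have "\<dots> \<le> \<bar>L\<bar> * lp_norm p (T x)" by (intro mult_right_mono) auto
    also have "\<dots> \<le> \<bar>L\<bar> * (K * lp_norm p x)" using K that by (intro mult_left_mono) auto
    finally show ?thesis by (simp add: mult.assoc)
  qed
  then have bnd: "\<exists>M. \<forall>x\<in>lp p. norm (f (T x)) \<le> M * lp_norm p x" by blast
  show ?thesis
    using T f bnd mem by (auto simp: lp_dual_def lp_operators_def lp_adjoint_def lp_add(1)[OF p] lp_scale)
qed

lemma limitin_pullback_topology:
  "limitin (pullback_topology A f X) g l F \<longleftrightarrow>
     l \<in> A \<and> eventually (\<lambda>i. g i \<in> A) F \<and> limitin X (\<lambda>i. f (g i)) (f l) F"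
proof
  assume L: "limitin (pullback_topology A f X) g l F"
  then have l: "l \<in> A" "f l \<in> topspace X"
    using limitin_topspace[OF L] by (auto simp: topspace_pullback_topology)
  have ev: "eventually (\<lambda>i. g i \<in> f -` U \<inter> A) F" if "openin X U" "f l \<in> U" for U
    using that l by (intro limitinD[OF L]) (auto simp: openin_pullback_topology)
  have "eventually (\<lambda>i. g i \<in> A) F"
    using ev[OF openin_topspace l(2)] by (auto elim: eventually_mono)
  moreover have "limitin X (\<lambda>i. f (g i)) (f l) F"
    unfolding limitin_def
  proof (intro conjI allI impI l(2))
    fix U assume "openin X U \<and> f l \<in> U"
    then show "eventually (\<lambda>i. f (g i) \<in> U) F"
      using ev[of U] by (auto elim: eventually_mono)
  qed
  ultimately show "l \<in> A \<and> eventually (\<lambda>i. g i \<in> A) F \<and> limitin X (\<lambda>i. f (g i)) (f l) F"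
    using l by blast
next
  assume R: "l \<in> A \<and> eventually (\<lambda>i. g i \<in> A) F \<and> limitin X (\<lambda>i. f (g i)) (f l) F"
  show "limitin (pullback_topology A f X) g l F"
    unfolding limitin_def
  proof (intro conjI allI impI)
    show "l \<in> topspace (pullback_topology A f X)"
      using R limitin_topspace by (fastforce simp: topspace_pullback_topology)
    fix S assume "openin (pullback_topology A f X) S \<and> l \<in> S"
    then obtain U where U: "openin X U" "S = f -` U \<inter> A" "f l \<in> U"
      by (auto simp: openin_pullback_topology)
    have "eventually (\<lambda>i. f (g i) \<in> U) F" using R U by (auto simp: limitin_def)
    with R show "eventually (\<lambda>i. g i \<in> S) F"
      using U by (auto elim: eventually_elim2)
  qed
qed

lemma topspace_sot_star:
  assumes p: "1 \<le> p"
  shows "topspace (sot_star p) = lp_unit_operators p"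
proof -
  interpret M: Metric_space "lp p" "lp_dist p" by (rule Metric_space_lp[OF p])
  interpret D: Metric_space "lp_dual p" "lp_dual_dist p" by (rule Metric_space_lp_dual[OF p])
  show ?thesis
    using lp_adjoint_in_dual[OF p]
    by (auto simp: sot_star_def topspace_pullback_topology lp_topology_def lp_dual_topology_def
        lp_unit_operators_def lp_operators_def PiE_def)
qed

lemma limitin_sot_star:
  assumes p: "1 \<le> p"
  shows "limitin (sot_star p) T S F \<longleftrightarrow>
    S \<in> lp_unit_operators p \<and> eventually (\<lambda>i. T i \<in> lp_unit_operators p) F \<and>
    (\<forall>x\<in>lp p. ((\<lambda>i. lp_norm p (\<lambda>n. T i x n - S x n)) \<longlongrightarrow> 0) F) \<and>
    (\<forall>f\<in>lp_dual p. ((\<lambda>i. lp_dual_norm p (\<lambda>x. lp_adjoint p (T i) f x - lp_adjoint p S f x)) \<longlongrightarrow> 0) F)"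
    (is "_ \<longleftrightarrow> ?S \<and> ?T \<and> ?A \<and> ?B")
proof (cases "?S \<and> ?T")
  case False
  then show ?thesis by (auto simp: sot_star_def limitin_pullback_topology)
next
  case True
  interpret M: Metric_space "lp p" "lp_dist p" by (rule Metric_space_lp[OF p])
  interpret D: Metric_space "lp_dual p" "lp_dual_dist p" by (rule Metric_space_lp_dual[OF p])
  have S: "S \<in> lp_operators p" using True by (simp add: lp_unit_operators_def)
  have T: "eventually (\<lambda>i. T i \<in> lp_operators p) F"
    using True by (auto simp: lp_unit_operators_def elim: eventually_mono)
  have 1: "limitin (product_topology (\<lambda>_. lp_topology p) (lp p)) T S F \<longleftrightarrow> ?A"
  proof -
    have "limitin (lp_topology p) (\<lambda>i. T i x) (S x) F \<longleftrightarrow>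
        ((\<lambda>i. lp_norm p (\<lambda>n. T i x n - S x n)) \<longlongrightarrow> 0) F" if "x \<in> lp p" for x
    proof -
      have "S x \<in> lp p" "eventually (\<lambda>i. T i x \<in> lp p) F"
        using S T that by (auto simp: lp_operators_def elim!: eventually_mono)
      then show ?thesis
        by (simp add: lp_topology_def M.limitin_metric_dist_null lp_dist_def)
    qed
    moreover have "S \<in> extensional (lp p)"
      using S by (auto simp: lp_operators_def PiE_def)
    moreover have "eventually (\<lambda>i. T i \<in> topspace (product_topology (\<lambda>_. lp_topology p) (lp p))) F"
      using T by (auto simp: lp_operators_def lp_topology_def elim!: eventually_mono)
    ultimately show ?thesis
      by (simp add: limitin_componentwise)
  qed
  have 2: "limitin (product_topology (\<lambda>_. lp_dual_topology p) (lp_dual p))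
      (\<lambda>i. \<lambda>f\<in>lp_dual p. lp_adjoint p (T i) f) (\<lambda>f\<in>lp_dual p. lp_adjoint p S f) F \<longleftrightarrow> ?B"
  proof -
    have "limitin (lp_dual_topology p) (\<lambda>i. lp_adjoint p (T i) f) (lp_adjoint p S f) F \<longleftrightarrow>
        ((\<lambda>i. lp_dual_norm p (\<lambda>x. lp_adjoint p (T i) f x - lp_adjoint p S f x)) \<longlongrightarrow> 0) F"
      if f: "f \<in> lp_dual p" for f
    proof -
      have a: "lp_adjoint p S f \<in> lp_dual p" "eventually (\<lambda>i. lp_adjoint p (T i) f \<in> lp_dual p) F"
        using lp_adjoint_in_dual[OF p _ f] S T by (auto elim!: eventually_mono)
      then have "((\<lambda>i. lp_dual_dist p (lp_adjoint p (T i) f) (lp_adjoint p S f)) \<longlongrightarrow> 0) F \<longleftrightarrow>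
        ((\<lambda>i. lp_dual_norm p (\<lambda>x. lp_adjoint p (T i) f x - lp_adjoint p S f x)) \<longlongrightarrow> 0) F"
        by (intro filterlim_cong refl) (auto simp: lp_dual_dist_def elim!: eventually_mono)
      then show ?thesis
        using a by (simp add: lp_dual_topology_def D.limitin_metric_dist_null)
    qed
    moreover have "eventually (\<lambda>i. (\<lambda>f\<in>lp_dual p. lp_adjoint p (T i) f)
        \<in> topspace (product_topology (\<lambda>_. lp_dual_topology p) (lp_dual p))) F"
      using T lp_adjoint_in_dual[OF p] by (auto simp: lp_dual_topology_def elim!: eventually_mono)
    ultimately show ?thesis
      by (simp add: limitin_componentwise)
  qed
  show ?thesis
    using True 1 2 by (simp add: sot_star_def limitin_pullback_topology limitin_pairwise o_def)
qed

end

theory Submission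
  imports Defs
begin

text \<open>
  Two properties of a contraction \<open>T\<close> are generic: there are unit vectors of arbitrarily large index
  that \<open>T\<close> almost fixes, and the powers of \<open>T\<close> tend to 0 on every unit vector. Given both, choose
  indices \<open>M 0 < M 1 < \<dots>\<close> and times \<open>N 0 < N 1 < \<dots>\<close> such that up to time \<open>N k\<close> the unit vectors of
  index \<open>M j\<close> with \<open>j > k\<close> have hardly moved, while after it those with \<open>j \<le> k\<close> have almost died out.
  Put weights \<open>r ^ j\<close> on these unit vectors. For \<open>r\<close> close to 1 the norm of the tail beyond \<open>k\<close> exceeds
  the single weight \<open>r ^ k\<close> by any given factor, so that the tail dominates the one summand that is
  in motion. So all iterates of this vector are close in direction to vectors supported away from
  the coordinate 0. The cone of all \<open>z\<close> whose whole orbit keeps its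
  coordinate 0 below \<open>3/4\<close> of its norm then contains this vector but not \<open>unit_vec 0\<close>.
\<close>

section \<open>Contractions and unit vectors of the sequence space\<close>

definition unit_vec :: "nat \<Rightarrow> nat \<Rightarrow> complex" where
  "unit_vec j = (\<lambda>n. if n = j then 1 else 0)"

text \<open>Iterates are handled through this predicate because \<open>T ^^ 0\<close> is the
  identity, which is not extensional, so \<open>lp_unit_operators\<close> is not closed under
  powers.\<close>

definition lp_contraction :: "real \<Rightarrow> ((nat \<Rightarrow> complex) \<Rightarrow> (nat \<Rightarrow> complex)) \<Rightarrow> bool" where
  "lp_contraction p S \<longleftrightarrow>
     (\<forall>x\<in>lp p. S x \<in> lp p \<and> lp_norm p (S x) \<le> lp_norm p x) \<and>
     (\<forall>x\<in>lp p. \<forall>y\<in>lp p. S (\<lambda>n. x n + y n) = (\<lambda>n. S x n + S y n)) \<and>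
     (\<forall>c. \<forall>x\<in>lp p. S (\<lambda>n. c * x n) = (\<lambda>n. c * S x n))"

lemma lp_contractionD:
  assumes "lp_contraction p S" "x \<in> lp p"
  shows "S x \<in> lp p" "lp_norm p (S x) \<le> lp_norm p x" "S (\<lambda>n. c * x n) = (\<lambda>n. c * S x n)"
    and "y \<in> lp p \<Longrightarrow> S (\<lambda>n. x n + y n) = (\<lambda>n. S x n + S y n)"
  using assms by (auto simp: lp_contraction_def)

lemma lp_contraction_diff:
  assumes "lp_contraction p S" "x \<in> lp p" "y \<in> lp p"
  shows "S (\<lambda>n. x n - y n) = (\<lambda>n. S x n - S y n)"
  using lp_contractionD(4)[OF assms(1,2) lp_scale[OF assms(3)], of "-1"]
    lp_contractionD(3)[OF assms(1,3), of "-1"] by simp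

lemma lp_contraction_funpow:
  assumes "lp_contraction p S"
  shows "lp_contraction p (S ^^ n)"
proof (induction n)
  case 0
  show ?case by (auto simp: lp_contraction_def)
next
  case (Suc n)
  show ?case
    unfolding lp_contraction_def
  proof (intro conjI ballI allI)
    fix x assume x: "x \<in> lp p"
    note Sx = lp_contractionD(1)[OF Suc x]
    show "(S ^^ Suc n) x \<in> lp p"
      using lp_contractionD(1)[OF assms Sx] by simp
    show "lp_norm p ((S ^^ Suc n) x) \<le> lp_norm p x"
      using lp_contractionD(2)[OF assms Sx] lp_contractionD(2)[OF Suc x] by simp
    show "(S ^^ Suc n) (\<lambda>i. c * x i) = (\<lambda>i. c * (S ^^ Suc n) x i)" for c
      using lp_contractionD(3)[OF assms Sx, of c] lp_contractionD(3)[OF Suc x, of c] by simp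
    fix y assume y: "y \<in> lp p"
    show "(S ^^ Suc n) (\<lambda>i. x i + y i) = (\<lambda>i. (S ^^ Suc n) x i + (S ^^ Suc n) y i)"
      using lp_contractionD(4)[OF assms Sx lp_contractionD(1)[OF Suc y]] lp_contractionD(4)[OF Suc x y]
      by simp
  qed
qed

lemma lp_unit_operators_iff:
  assumes p: "1 \<le> p"
  shows "T \<in> lp_unit_operators p \<longleftrightarrow> T \<in> extensional (lp p) \<and> lp_contraction p T"
proof
  assume T: "T \<in> lp_unit_operators p"
  then have op: "T \<in> lp_operators p" and le: "lp_opnorm p T \<le> 1"
    by (auto simp: lp_unit_operators_def)
  have mem: "T x \<in> lp p" if "x \<in> lp p" for x
    using op that by (auto simp: lp_operators_def)
  have sc: "T (\<lambda>n. c * x n) = (\<lambda>n. c * T x n)" if "x \<in> lp p" for c x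
    using op that by (auto simp: lp_operators_def)
  obtain K where K: "\<And>x. x \<in> lp p \<Longrightarrow> lp_norm p (T x) \<le> K * lp_norm p x"
    using op unfolding lp_operators_def by blast
  have "lp_norm p (T x) \<le> \<bar>K\<bar>" if "x \<in> lp p" "lp_norm p x \<le> 1" for x
  proof -
    have "lp_norm p (T x) \<le> K * lp_norm p x" using K that by blast
    also have "\<dots> \<le> \<bar>K\<bar> * 1" using that by (intro mult_mono) auto
    finally show ?thesis by simp
  qed
  \<comment> \<open>A real supremum bounds its members only over a set that is bounded above; the
    constant \<open>K\<close> provides this.\<close>
  then have bdd: "bdd_above ((\<lambda>x. lp_norm p (T x)) ` {x \<in> lp p. lp_norm p x \<le> 1})"
    by (auto intro!: bdd_aboveI[where M = "\<bar>K\<bar>"])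
  have unit: "lp_norm p (T x) \<le> 1" if "x \<in> lp p" "lp_norm p x \<le> 1" for x
    using cSUP_upper[OF _ bdd, of x] that le by (simp add: lp_opnorm_def)
  have "lp_norm p (T x) \<le> lp_norm p x" if x: "x \<in> lp p" for x
  \<comment> \<open>A vector of norm 0 cannot be normalised; there the bound by \<open>K\<close>
    already forces the image to have norm 0.\<close>
  proof (cases "lp_norm p x = 0")
    case True
    then show ?thesis using K[OF x] by simp
  next
    case False
    then have pos: "lp_norm p x > 0" by (simp add: less_le)
    define c where "c = complex_of_real (1 / lp_norm p x)"
    have nc: "norm c = 1 / lp_norm p x"
      using pos by (simp add: c_def norm_divide)
    have "lp_norm p (T (\<lambda>n. c * x n)) \<le> 1"
      using pos p x nc by (intro unit lp_scale) (simp_all add: lp_norm_scale)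
    then show ?thesis
      using pos p x nc mem by (simp add: sc lp_norm_scale)
  qed
  then show "T \<in> extensional (lp p) \<and> lp_contraction p T"
    using op by (auto simp: lp_contraction_def lp_operators_def PiE_def)
next
  assume T: "T \<in> extensional (lp p) \<and> lp_contraction p T"
  have le: "lp_norm p (T x) \<le> 1 * lp_norm p x" if "x \<in> lp p" for x
    using lp_contractionD(2)[of p T] T that by simp
  have "(\<lambda>n. 0) \<in> {x \<in> lp p. lp_norm p x \<le> 1}" by simp
  then have "{x \<in> lp p. lp_norm p x \<le> 1} \<noteq> {}" by blast
  then have "(SUP x\<in>{x \<in> lp p. lp_norm p x \<le> 1}. lp_norm p (T x)) \<le> 1"
    using le by (intro cSUP_least) (auto intro: order_trans)
  moreover have "T \<in> lp p \<rightarrow>\<^sub>E lp p"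
    using T lp_contractionD(1)[of p T] by (auto simp: PiE_def)
  moreover have "\<exists>K. \<forall>x\<in>lp p. lp_norm p (T x) \<le> K * lp_norm p x"
    using le by blast
  ultimately show "T \<in> lp_unit_operators p"
    using T unfolding lp_unit_operators_def lp_operators_def lp_opnorm_def lp_contraction_def by blast
qed

section \<open>Finite supports, coordinates and triangle inequalities\<close>

lemma lp_finite_support:
  assumes "finite A" "\<And>n. n \<notin> A \<Longrightarrow> x n = 0"
  shows "x \<in> lp p" "lp_norm p x = (\<Sum>n\<in>A. norm (x n) powr p) powr (1 / p)"
proof -
  show "x \<in> lp p"
    unfolding lp_def using assms by (auto intro!: summable_finite[OF assms(1)])
  show "lp_norm p x = (\<Sum>n\<in>A. norm (x n) powr p) powr (1 / p)"
    unfolding lp_norm_def using assms by (subst suminf_finite[OF assms(1)]) auto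
qed

lemma unit_vec_lp [simp]: "unit_vec j \<in> lp p"
  by (rule lp_finite_support[of "{j}"]) (auto simp: unit_vec_def)

lemma lp_norm_unit_vec [simp]: "lp_norm p (unit_vec j) = 1"
  by (subst lp_finite_support[of "{j}"]) (auto simp: unit_vec_def)

lemma norm_component_le_lp_norm:
  assumes "x \<in> lp p" "0 < p"
  shows "norm (x n) \<le> lp_norm p x"
proof -
  have "(\<Sum>n\<in>{n}. norm (x n) powr p) \<le> (\<Sum>n. norm (x n) powr p)"
    using assms by (intro sum_le_suminf) (auto simp: lp_def)
  then have "(norm (x n) powr p) powr (1 / p) \<le> lp_norm p x"
    unfolding lp_norm_def using assms by (intro powr_mono2) auto
  then show ?thesis using assms by (simp add: powr_powr)
qed

lemma lp_component_tendsto_0: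
  assumes "x \<in> lp p" "0 < p"
  shows "(\<lambda>n. norm (x n)) \<longlonglongrightarrow> 0"
proof -
  have lim: "(\<lambda>n. norm (x n) powr p) \<longlonglongrightarrow> 0"
    using assms by (auto simp: lp_def intro: summable_LIMSEQ_zero)
  have "(\<lambda>n. (norm (x n) powr p) powr (1 / p)) \<longlonglongrightarrow> 0"
    by (rule tendsto_zero_powrI[OF lim tendsto_const]) (use assms in auto)
  then show ?thesis using assms by (simp add: powr_powr)
qed

lemma lp_norm_minus_commute:
  "lp_norm p (\<lambda>n. x n - y n) = lp_norm p (\<lambda>n. y n - x n)"
  by (simp add: lp_norm_def norm_minus_commute)

lemma lp_norm_diff_triangle:
  assumes "1 \<le> p" "x \<in> lp p" "y \<in> lp p"
  shows "lp_norm p x \<le> lp_norm p y + lp_norm p (\<lambda>n. x n - y n)"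
  using lp_add(2)[OF assms(1,3) lp_diff[OF assms]] by simp

lemma lp_norm_diff_le:
  assumes "1 \<le> p" "x \<in> lp p" "y \<in> lp p"
  shows "lp_norm p (\<lambda>n. x n - y n) \<le> lp_norm p x + lp_norm p y"
  using lp_add(2)[OF assms(1,2) lp_scale[OF assms(3)], of "-1"] lp_norm_scale[OF assms(3), of "-1"]
    assms(1) by simp

section \<open>Bounded functionals on the unit vectors\<close>

lemma lp_dualD:
  assumes "f \<in> lp_dual p" "x \<in> lp p"
  shows "f (\<lambda>n. c * x n) = c * f x" "y \<in> lp p \<Longrightarrow> f (\<lambda>n. x n + y n) = f x + f y"
  using assms by (auto simp: lp_dual_def)

lemma lp_dual_diff:
  assumes "f \<in> lp_dual p" "x \<in> lp p" "y \<in> lp p"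
  shows "f (\<lambda>n. x n - y n) = f x - f y"
  using lp_dualD(2)[OF assms(1,2) lp_scale[OF assms(3)], of "-1"]
    lp_dualD(1)[OF assms(1,3), of "-1"] by simp

lemma lp_dual_finite_support:
  assumes f: "f \<in> lp_dual p" and "finite A"
  shows "f (\<lambda>n. if n \<in> A then c n else 0) = (\<Sum>n\<in>A. c n * f (unit_vec n))"
  using \<open>finite A\<close>
proof (induction A rule: finite_induct)
  case empty
  show ?case using lp_dualD(1)[OF f lp_zero, of 0] by simp
next
  case (insert a A)
  have "(\<lambda>n. if n \<in> insert a A then c n else 0)
      = (\<lambda>n. c a * unit_vec a n + (if n \<in> A then c n else 0))"
    using insert by (auto simp: unit_vec_def fun_eq_iff)
  moreover have "(\<lambda>n. if n \<in> A then c n else 0) \<in> lp p"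
    using insert by (intro lp_finite_support[of A]) auto
  ultimately show ?case
    using insert by (simp add: lp_dualD[OF f] lp_scale)
qed

text \<open>If \<open>f\<close> were at least \<open>e\<close> in modulus on infinitely many unit
  vectors, a sum of \<open>K\<close> of them with aligned phases would have norm
  \<open>K powr (1 / p)\<close> but a value of at least \<open>K * e\<close>. For large
  \<open>K\<close> this contradicts boundedness, since \<open>1 / p < 1\<close>.\<close>

lemma unit_vec_weakly_null:
  assumes p: "1 < p" and f: "f \<in> lp_dual p"
  shows "(\<lambda>n. norm (f (unit_vec n))) \<longlonglongrightarrow> 0"
proof (rule ccontr)
  assume "\<not> ?thesis"
  then obtain e where e: "e > 0" and "\<not> (\<forall>\<^sub>F n in sequentially. norm (f (unit_vec n)) < e)"
    by (auto simp: tendsto_iff)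
  then have inf: "infinite {n. norm (f (unit_vec n)) \<ge> e}"
    unfolding infinite_nat_iff_unbounded_le eventually_sequentially
    by (auto simp: not_less)
  obtain L where L: "\<And>x. x \<in> lp p \<Longrightarrow> norm (f x) \<le> L * lp_norm p x"
    using f unfolding lp_dual_def by blast
  have "real K * e \<le> L * real K powr (1 / p)" if K: "K > 0" for K
  proof -
    obtain A where A: "finite A" "card A = K" "A \<subseteq> {n. norm (f (unit_vec n)) \<ge> e}"
      using infinite_arbitrarily_large[OF inf] by blast
    \<comment> \<open>The conjugate phase: every summand of \<open>f ?z\<close> becomes real and
      positive, so nothing cancels.\<close>
    define c where "c n = cnj (sgn (f (unit_vec n)))" for n
    let ?z = "\<lambda>n. if n \<in> A then c n else 0"
    have nz: "norm (c n) = 1" "c n * f (unit_vec n) = of_real (norm (f (unit_vec n)))" if "n \<in> A" for n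
    proof -
      have "f (unit_vec n) \<noteq> 0" using A that e by force
      then show "norm (c n) = 1" by (simp add: c_def norm_sgn)
      show "c n * f (unit_vec n) = of_real (norm (f (unit_vec n)))"
        using \<open>f (unit_vec n) \<noteq> 0\<close> complex_norm_square[of "f (unit_vec n)"]
        by (simp add: c_def sgn_div_norm scaleR_conv_of_real power2_eq_square field_simps)
    qed
    have mem: "?z \<in> lp p" and norm_z: "lp_norm p ?z = real K powr (1 / p)"
      using lp_finite_support[of A ?z] A by (auto simp: nz)
    have "real K * e \<le> (\<Sum>n\<in>A. norm (f (unit_vec n)))"
      using sum_bounded_below[of A e "\<lambda>n. norm (f (unit_vec n))"] A by auto
    also have "\<dots> = norm (f ?z)"
      using A nz by (simp add: lp_dual_finite_support[OF f] sum_nonneg del: of_real_sum flip: of_real_sum)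
    also have "\<dots> \<le> L * real K powr (1 / p)"
      using L[OF mem] norm_z by simp
    finally show ?thesis .
  qed
  then have bound: "real K powr (1 - 1 / p) \<le> L / e" if "K > 0" for K
    using that e by (simp add: powr_diff field_simps)
  \<comment> \<open>\<open>b\<close> exceeds \<open>L / e\<close> and is positive, so an integer
    \<open>K\<close> above its \<open>1 / s\<close>-th power violates \<open>bound\<close>.\<close>
  define b where "b = \<bar>L / e\<bar> + 1"
  define s where "s = 1 - 1 / p"
  have s: "s > 0" using p by (simp add: s_def)
  obtain K where K: "b powr (1 / s) < real K" using reals_Archimedean2 by blast
  then have "K > 0" by (smt (verit) gr0I of_nat_0 powr_ge_zero)
  have "b = (b powr (1 / s)) powr s" using s by (simp add: powr_powr b_def)
  also have "\<dots> \<le> real K powr s" using K s by (intro powr_mono2) auto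
  also have "\<dots> \<le> L / e" using bound[OF \<open>K > 0\<close>] by (simp add: s_def)
  finally show False unfolding b_def by linarith
qed

section \<open>Generic properties\<close>

text \<open>The complement of a dense open set is closed with empty interior, and every point
  outside \<open>S\<close> lies in one of these complements.\<close>

lemma comeager_in_supset_Inter:
  assumes "countable \<U>" and "\<And>U. U \<in> \<U> \<Longrightarrow> openin X U" "\<And>U. U \<in> \<U> \<Longrightarrow> X closure_of U = topspace X"
    and "S \<subseteq> topspace X" "topspace X \<inter> \<Inter>\<U> \<subseteq> S"
  shows "comeager_in X S"
proof -
  \<comment> \<open>\<open>S\<close> is removed as well because \<open>meager_in\<close> asks for
    the exact union, not for a covering.\<close>
  have "nowhere_dense_in X (topspace X - S - U)" if "U \<in> \<U>" for U
  proof -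
    have "X closure_of (topspace X - S - U) \<subseteq> topspace X - U"
      using assms(2)[OF that] by (intro closure_of_minimal) auto
    then have "X interior_of (X closure_of (topspace X - S - U)) \<subseteq> X interior_of (topspace X - U)"
      by (rule interior_of_mono)
    also have "\<dots> = {}" using assms(3)[OF that] by (simp add: interior_of_complement)
    finally show ?thesis by (auto simp: nowhere_dense_in_def)
  qed
  moreover have "topspace X - S = \<Union>((\<lambda>U. topspace X - S - U) ` \<U>)"
    using assms(5) by blast
  ultimately show ?thesis
    using assms(1,4) unfolding comeager_in_def meager_in_def
    by (intro conjI exI[of _ "(\<lambda>U. topspace X - S - U) ` \<U>"]) auto
qed

lemma closure_of_eq_topspace_sequentially:
  assumes "\<And>a. a \<in> topspace X \<Longrightarrow> \<exists>s. (\<forall>i::nat. s i \<in> U) \<and> limitin X s a sequentially"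
  shows "X closure_of U = topspace X"
proof -
  have "a \<in> X closure_of U" if a: "a \<in> topspace X" for a
    unfolding in_closure_of
  proof (intro conjI allI impI a)
    fix W assume W: "a \<in> W \<and> openin X W"
    obtain s where s: "\<And>i::nat. s i \<in> U" "limitin X s a sequentially"
      using assms[OF a] by blast
    then have "\<forall>\<^sub>F i in sequentially. s i \<in> W" using W by (auto simp: limitin_def)
    then obtain i where "s i \<in> W" by (auto simp: eventually_sequentially)
    then show "\<exists>y. y \<in> U \<and> y \<in> W" using s(1) by blast
  qed
  then show ?thesis using closure_of_subset_topspace[of X U] by blast
qed

text \<open>Composition is continuous here because the operators are uniformly bounded:
  \<open>T\<close> carries the error of the first \<open>n\<close> steps along without enlarging it,
  and the new error is that of \<open>T\<close> against \<open>S\<close> at the fixed vector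
  \<open>(S ^^ n) x\<close>.\<close>

lemma continuous_map_sot_star_funpow:
  assumes p: "1 \<le> p" and x: "x \<in> lp p"
  shows "continuous_map (sot_star p) (lp_topology p) (\<lambda>T. (T ^^ n) x)"
  unfolding continuous_map_atin topspace_sot_star[OF p]
proof
  fix S assume S: "S \<in> lp_unit_operators p"
  interpret M: Metric_space "lp p" "lp_dist p" by (rule Metric_space_lp[OF p])
  let ?F = "atin (sot_star p) S"
  \<comment> \<open>Continuity of the identity map gives convergence along the punctured
    neighbourhood filter, so the description of limits in \<open>sot_star\<close> applies.\<close>
  have "limitin (sot_star p) (\<lambda>T. T) S ?F"
    using continuous_map_id[of "sot_star p"] S
    unfolding continuous_map_atin topspace_sot_star[OF p] by (simp add: id_def)
  then have ev: "\<forall>\<^sub>F T in ?F. T \<in> lp_unit_operators p"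
    and lim: "\<And>y. y \<in> lp p \<Longrightarrow> ((\<lambda>T. lp_norm p (\<lambda>n. T y n - S y n)) \<longlongrightarrow> 0) ?F"
    by (auto simp: limitin_sot_star[OF p])
  have cS: "lp_contraction p S" using S by (simp add: lp_unit_operators_iff[OF p])
  have "((\<lambda>T. lp_norm p (\<lambda>i. (T ^^ n) x i - (S ^^ n) x i)) \<longlongrightarrow> 0) ?F"
  proof (induction n)
    case 0
    show ?case by simp
  next
    case (Suc n)
    let ?y = "(S ^^ n) x"
    have y: "?y \<in> lp p" using lp_contractionD(1)[OF lp_contraction_funpow[OF cS] x] .
    have lim': "((\<lambda>T. lp_norm p (\<lambda>i. (T ^^ n) x i - ?y i) + lp_norm p (\<lambda>i. T ?y i - S ?y i)) \<longlongrightarrow> 0) ?F"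
      using tendsto_add[OF Suc lim[OF y]] by simp
    show ?case
    proof (rule tendsto_sandwich[OF _ _ tendsto_const lim'])
      show "\<forall>\<^sub>F T in ?F. lp_norm p (\<lambda>i. (T ^^ Suc n) x i - (S ^^ Suc n) x i)
          \<le> lp_norm p (\<lambda>i. (T ^^ n) x i - ?y i) + lp_norm p (\<lambda>i. T ?y i - S ?y i)"
        using ev
      proof eventually_elim
        case (elim T)
        then have cT: "lp_contraction p T" by (simp add: lp_unit_operators_iff[OF p])
        have z: "(T ^^ n) x \<in> lp p" using lp_contractionD(1)[OF lp_contraction_funpow[OF cT] x] .
        have d: "(\<lambda>i. (T ^^ n) x i - ?y i) \<in> lp p" using lp_diff[OF p z y] .
        have "(\<lambda>i. (T ^^ Suc n) x i - (S ^^ Suc n) x i)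
            = (\<lambda>i. T (\<lambda>i. (T ^^ n) x i - ?y i) i + (T ?y i - S ?y i))"
          by (simp add: lp_contraction_diff[OF cT z y])
        then show ?case
          using lp_add(2)[OF p lp_contractionD(1)[OF cT d]
              lp_diff[OF p lp_contractionD(1)[OF cT y] lp_contractionD(1)[OF cS y]]]
            lp_contractionD(2)[OF cT d] by simp
      qed
    qed auto
  qed
  moreover have "\<forall>\<^sub>F T in ?F. (T ^^ n) x \<in> lp p"
    using ev by eventually_elim
      (auto simp: lp_unit_operators_iff[OF p] intro: lp_contractionD(1)[OF lp_contraction_funpow x])
  moreover have "(S ^^ n) x \<in> lp p"
    using lp_contractionD(1)[OF lp_contraction_funpow[OF cS] x] .
  ultimately show "limitin (lp_topology p) (\<lambda>T. (T ^^ n) x) ((S ^^ n) x) ?F"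
    by (simp add: lp_topology_def M.limitin_metric_dist_null lp_dist_def)
qed

lemma openin_sot_star_funpow_ball:
  assumes p: "1 \<le> p" and x: "x \<in> lp p" and y: "y \<in> lp p"
  shows "openin (sot_star p) {T \<in> lp_unit_operators p. lp_norm p (\<lambda>i. (T ^^ n) x i - y i) < e}"
proof -
  interpret M: Metric_space "lp p" "lp_dist p" by (rule Metric_space_lp[OF p])
  have "openin (sot_star p) {T \<in> topspace (sot_star p). (T ^^ n) x \<in> M.mball y e}"
    using M.openin_mball
    by (intro openin_continuous_map_preimage[OF continuous_map_sot_star_funpow[OF p x]])
      (auto simp: lp_topology_def)
  also have "{T \<in> topspace (sot_star p). (T ^^ n) x \<in> M.mball y e}
      = {T \<in> lp_unit_operators p. lp_norm p (\<lambda>i. (T ^^ n) x i - y i) < e}"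
    using y lp_contractionD(1)[OF lp_contraction_funpow x]
    by (auto simp: topspace_sot_star[OF p] lp_dist_def lp_unit_operators_iff[OF p]
        lp_norm_minus_commute[of p y])
  finally show ?thesis .
qed

text \<open>The bound \<open>K f i\<close> is uniform over the unit ball, so it controls the dual
  norm of the difference of the adjoints at \<open>f\<close>.\<close>

lemma limitin_sot_starI:
  assumes p: "1 \<le> p" and S: "S \<in> lp_unit_operators p" and T: "\<And>i::nat. T i \<in> lp_unit_operators p"
    and lim: "\<And>x. x \<in> lp p \<Longrightarrow> (\<lambda>i. lp_norm p (\<lambda>n. T i x n - S x n)) \<longlonglongrightarrow> 0"
    and dual: "\<And>f i x. f \<in> lp_dual p \<Longrightarrow> x \<in> lp p \<Longrightarrow> lp_norm p x \<le> 1 \<Longrightarrow>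
      norm (f (T i x) - f (S x)) \<le> K f i"
    and K: "\<And>f. f \<in> lp_dual p \<Longrightarrow> K f \<longlonglongrightarrow> 0"
  shows "limitin (sot_star p) T S sequentially"
  unfolding limitin_sot_star[OF p]
proof (intro conjI ballI S lim always_eventually allI T)
  fix f assume f: "f \<in> lp_dual p"
  have z: "(\<lambda>n. 0) \<in> {x \<in> lp p. lp_norm p x \<le> 1}" by simp
  have adj: "lp_adjoint p (T i) f \<in> lp_dual p" "lp_adjoint p S f \<in> lp_dual p" for i
    using S T f by (auto intro!: lp_adjoint_in_dual[OF p] simp: lp_unit_operators_def)
  have eq: "lp_dual_norm p (\<lambda>x. lp_adjoint p (T i) f x - lp_adjoint p S f x)
      = lp_dual_dist p (lp_adjoint p (T i) f) (lp_adjoint p S f)" for i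
    using adj by (simp add: lp_dual_dist_def)
  interpret D: Metric_space "lp_dual p" "lp_dual_dist p" by (rule Metric_space_lp_dual[OF p])
  have le: "lp_dual_dist p (lp_adjoint p (T i) f) (lp_adjoint p S f) \<le> K f i" for i
    using adj dual[OF f] by (intro lp_dual_dist_least) (auto simp: lp_adjoint_def)
  show "(\<lambda>i. lp_dual_norm p (\<lambda>x. lp_adjoint p (T i) f x - lp_adjoint p S f x)) \<longlonglongrightarrow> 0"
    unfolding eq by (rule tendsto_sandwich[OF _ _ tendsto_const K[OF f]]) (auto simp: le)
qed auto

text \<open>Multiplying \<open>S\<close> by a factor below 1 makes its powers decay geometrically,
  and as the factor tends to 1 the products converge to \<open>S\<close> uniformly on the unit
  ball.\<close>

lemma dense_strongly_null:
  assumes p: "1 < p" and x: "x \<in> lp p" and e: "e > 0"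
  shows "sot_star p closure_of {T \<in> lp_unit_operators p. \<exists>n. lp_norm p ((T ^^ n) x) < e}
    = topspace (sot_star p)"
proof (rule closure_of_eq_topspace_sequentially)
  have p1: "1 \<le> p" using p by simp
  fix S assume "S \<in> topspace (sot_star p)"
  then have S: "S \<in> lp_unit_operators p" by (simp add: topspace_sot_star[OF p1])
  then have cS: "lp_contraction p S" by (simp add: lp_unit_operators_iff[OF p1])
  define r :: "nat \<Rightarrow> real" where "r i = 1 - 1 / real (Suc i)" for i
  have r: "0 \<le> r i" "r i < 1" for i by (auto simp: r_def)
  define T where "T i = (\<lambda>x\<in>lp p. \<lambda>n. of_real (r i) * S x n)" for i
  have nT: "lp_norm p (T i y) = r i * lp_norm p (S y)" if "y \<in> lp p" for i y
    using that p r lp_contractionD(1)[OF cS that] by (simp add: T_def lp_norm_scale)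
  have cT: "lp_contraction p (T i)" for i
    unfolding lp_contraction_def
  proof (intro conjI ballI allI)
    fix x assume x: "x \<in> lp p"
    show "T i x \<in> lp p"
      using x lp_contractionD[OF cS x] by (simp add: T_def lp_scale)
    show "lp_norm p (T i x) \<le> lp_norm p x"
      using mult_mono[of "r i" 1 "lp_norm p (S x)" "lp_norm p x"] nT[OF x] r[of i] lp_contractionD(2)[OF cS x]
      by simp
    show "T i (\<lambda>n. c * x n) = (\<lambda>n. c * T i x n)" for c
      using x by (simp add: T_def lp_scale lp_contractionD(3)[OF cS] mult.left_commute)
    fix y assume y: "y \<in> lp p"
    show "T i (\<lambda>n. x n + y n) = (\<lambda>n. T i x n + T i y n)"
      using x y by (simp add: T_def lp_add[OF p1] lp_contractionD(4)[OF cS] distrib_left)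
  qed
  have T: "T i \<in> lp_unit_operators p" for i
    using cT by (auto simp: lp_unit_operators_iff[OF p1] T_def)
  have pw: "lp_norm p ((T i ^^ n) x) \<le> r i ^ n * lp_norm p x" for i n
  proof (induction n)
    case (Suc n)
    have mem: "(T i ^^ n) x \<in> lp p" using lp_contractionD(1)[OF lp_contraction_funpow[OF cT] x] .
    have "lp_norm p ((T i ^^ Suc n) x) \<le> r i * lp_norm p ((T i ^^ n) x)"
      using nT[OF mem] lp_contractionD(2)[OF cS mem] r[of i] by (simp add: mult_left_mono)
    also have "\<dots> \<le> r i * (r i ^ n * lp_norm p x)" using Suc r by (intro mult_left_mono)
    finally show ?case by (simp add: mult.assoc)
  qed simp
  have "\<exists>n. lp_norm p ((T i ^^ n) x) < e" for i
  proof -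
    have "(\<lambda>n. r i ^ n * lp_norm p x) \<longlonglongrightarrow> 0 * lp_norm p x"
      using r[of i] by (intro tendsto_mult LIMSEQ_realpow_zero tendsto_const) auto
    then have "\<forall>\<^sub>F n in sequentially. r i ^ n * lp_norm p x < e"
      using e by (simp add: order_tendsto_iff)
    then obtain n where "r i ^ n * lp_norm p x < e" by (auto simp: eventually_sequentially)
    then show ?thesis using pw[of n i] by (intro exI[of _ n]) simp
  qed
  moreover have "limitin (sot_star p) T S sequentially"
  proof (rule limitin_sot_starI[OF p1 S T])
    have d: "(\<lambda>n. T i y n - S y n) = (\<lambda>n. - of_real (1 / real (Suc i)) * S y n)" if "y \<in> lp p" for i y
      using that by (simp add: T_def r_def algebra_simps)
    have lim: "(\<lambda>i. 1 / real (Suc i) * c) \<longlonglongrightarrow> 0" for c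
      using tendsto_mult[OF LIMSEQ_inverse_real_of_nat tendsto_const[of c]]
      by (simp add: inverse_eq_divide)
    show "(\<lambda>i. lp_norm p (\<lambda>n. T i y n - S y n)) \<longlonglongrightarrow> 0" if y: "y \<in> lp p" for y
    proof -
      have "lp_norm p (\<lambda>n. T i y n - S y n) = 1 / real (Suc i) * lp_norm p (S y)" for i
        unfolding d[OF y] using p lp_contractionD(1)[OF cS y]
        by (subst lp_norm_scale) (auto simp: norm_divide simp del: of_nat_Suc)
      then show ?thesis using lim by simp
    qed
    fix f assume f: "f \<in> lp_dual p"
    let ?g = "lp_adjoint p S f"
    \<comment> \<open>The distance to the zero functional serves as the norm of the adjoint at
      \<open>f\<close>; zero is restricted to \<open>lp p\<close> to be extensional.\<close>
    show "(\<lambda>i. 1 / real (Suc i) * lp_dual_dist p ?g (\<lambda>x\<in>lp p. 0)) \<longlonglongrightarrow> 0"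
      by (rule lim)
    fix i y assume y: "y \<in> lp p" "lp_norm p y \<le> 1"
    have zero: "(\<lambda>x\<in>lp p. 0) \<in> lp_dual p"
      by (auto simp: lp_dual_def lp_add[OF p1] lp_scale intro!: exI[of _ 0])
    have "norm (f (S y)) \<le> lp_dual_dist p ?g (\<lambda>x\<in>lp p. 0)"
      using lp_dual_dist_upper[OF lp_adjoint_in_dual[OF p1 _ f] zero y, of S] S y
      by (auto simp: lp_adjoint_def lp_unit_operators_def)
    moreover have "f (T i y) - f (S y) = - of_real (1 / real (Suc i)) * f (S y)"
      using y(1) lp_dualD(1)[OF f lp_contractionD(1)[OF cS y(1)], of "of_real (r i)"]
      by (simp add: T_def) (simp add: r_def algebra_simps)
    ultimately show "norm (f (T i y) - f (S y)) \<le> 1 / real (Suc i) * lp_dual_dist p ?g (\<lambda>x\<in>lp p. 0)"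
      by (simp add: norm_mult norm_divide divide_right_mono del: of_nat_Suc)
  qed
  ultimately show "\<exists>s. (\<forall>i. s i \<in> {T \<in> lp_unit_operators p. \<exists>n. lp_norm p ((T ^^ n) x) < e}) \<and>
      limitin (sot_star p) s S sequentially"
    using T by blast
qed

text \<open>The \<open>p\<close>-th power of the norm is additive over disjoint supports. This lets
  one coordinate be exchanged with exact control of the norm.\<close>

lemma lp_fun_upd:
  assumes p: "0 < p" and x: "x \<in> lp p"
  shows "x(M := a) \<in> lp p"
    and "lp_norm p (x(M := a)) powr p = lp_norm p (x(M := 0)) powr p + norm a powr p"
proof -
  let ?f = "\<lambda>n. norm ((x(M := 0)) n) powr p" and ?g = "\<lambda>n. if n = M then norm a powr p else 0"
  have "summable ?f"
    by (rule summable_comparison_test'[of "\<lambda>n. norm (x n) powr p" 0]) (use x in \<open>auto simp: lp_def\<close>)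
  then have 0: "x(M := 0) \<in> lp p" and f: "?f sums lp_norm p (x(M := 0)) powr p"
    using lp_norm_powr[of "x(M := 0)" p] p by (auto simp: lp_def summable_sums)
  have "(\<lambda>n. ?f n + ?g n) sums (lp_norm p (x(M := 0)) powr p + norm a powr p)"
    using sums_add[OF f sums_single[of M "\<lambda>_. norm a powr p"]] .
  moreover have "(\<lambda>n. ?f n + ?g n) = (\<lambda>n. norm ((x(M := a)) n) powr p)"
    by auto
  ultimately have s: "(\<lambda>n. norm ((x(M := a)) n) powr p) sums (lp_norm p (x(M := 0)) powr p + norm a powr p)"
    by simp
  then show mem: "x(M := a) \<in> lp p" unfolding lp_def mem_Collect_eq by (rule sums_summable)
  show "lp_norm p (x(M := a)) powr p = lp_norm p (x(M := 0)) powr p + norm a powr p"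
    using sums_unique[OF s] lp_norm_powr[OF mem p] by simp
qed

text \<open>
  Replacing the row and the column of index \<open>M\<close> of a contraction by those of the identity gives a
  contraction that fixes \<open>unit_vec M\<close>. As \<open>M\<close> grows it converges to the original operator; for the
  adjoints this needs the unit vectors to be weakly null, hence \<open>1 < p\<close>.
\<close>

lemma dense_almost_fixed:
  assumes p: "1 < p" and e: "e > 0"
  shows "sot_star p closure_of
    {T \<in> lp_unit_operators p. \<exists>M\<ge>m. lp_norm p (\<lambda>n. T (unit_vec M) n - unit_vec M n) < e}
    = topspace (sot_star p)"
proof (rule closure_of_eq_topspace_sequentially)
  have p1: "1 \<le> p" and p0: "0 < p" using p by auto
  fix S assume "S \<in> topspace (sot_star p)"
  then have S: "S \<in> lp_unit_operators p" by (simp add: topspace_sot_star[OF p1])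
  then have cS: "lp_contraction p S" by (simp add: lp_unit_operators_iff[OF p1])
  define R where "R M = (\<lambda>x\<in>lp p. (S (x(M := 0)))(M := x M))" for M
  have S0: "S (\<lambda>n. 0) = (\<lambda>n. 0)"
    using lp_contractionD(3)[OF cS lp_zero, of 0] by simp
  have R: "R M \<in> lp_unit_operators p" for M
    unfolding lp_unit_operators_iff[OF p1] lp_contraction_def
  proof (intro conjI ballI allI)
    show "R M \<in> extensional (lp p)" by (auto simp: R_def)
    fix x assume x: "x \<in> lp p"
    note x0 = lp_fun_upd(1)[OF p0 x, of M 0]
    note Sx0 = lp_contractionD(1)[OF cS x0]
    show Rx: "R M x \<in> lp p" using x lp_fun_upd(1)[OF p0 Sx0] by (simp add: R_def)
    \<comment> \<open>Away from the coordinate \<open>M\<close> the norm does not grow; adding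
      \<open>norm (x M) powr p\<close> on both sides then compares \<open>R M x\<close> with
      \<open>x\<close>.\<close>
    have "lp_norm p ((S (x(M := 0)))(M := 0)) powr p \<le> lp_norm p (S (x(M := 0))) powr p"
      using lp_fun_upd(2)[OF p0 Sx0, of M "S (x(M := 0)) M"] by simp
    also have "\<dots> \<le> lp_norm p (x(M := 0)) powr p"
      using lp_contractionD(2)[OF cS x0] p0 by (intro powr_mono2) auto
    finally have "lp_norm p (R M x) powr p \<le> lp_norm p x powr p"
      using lp_fun_upd(2)[OF p0 Sx0, of M "x M"] lp_fun_upd(2)[OF p0 x, of M "x M"] x
      by (simp add: R_def)
    then show "lp_norm p (R M x) \<le> lp_norm p x"
      using powr_less_mono2[OF p0 lp_norm_nonneg, of p x "lp_norm p (R M x)"] by linarith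
    show "R M (\<lambda>n. c * x n) = (\<lambda>n. c * R M x n)" for c
    proof -
      have "(\<lambda>n. c * x n)(M := 0) = (\<lambda>n. c * (x(M := 0)) n)" by auto
      then show ?thesis
        using lp_contractionD(3)[OF cS x0, of c] x lp_scale[OF x, of c] by (simp add: R_def) auto
    qed
    fix y assume y: "y \<in> lp p"
    have "(\<lambda>n. x n + y n)(M := 0) = (\<lambda>n. (x(M := 0)) n + (y(M := 0)) n)" by auto
    then show "R M (\<lambda>n. x n + y n) = (\<lambda>n. R M x n + R M y n)"
      using lp_contractionD(4)[OF cS x0 lp_fun_upd(1)[OF p0 y, of M 0]] x y lp_add(1)[OF p1 x y]
      by (simp add: R_def) auto
  qed
  have Rfix: "R M (unit_vec M) = unit_vec M" for M
  proof -
    have "(unit_vec M)(M := 0) = (\<lambda>n. 0)" by (auto simp: unit_vec_def)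
    then have "R M (unit_vec M) = (\<lambda>n. 0)(M := unit_vec M M)" by (simp add: R_def S0)
    then show ?thesis by (auto simp: unit_vec_def)
  qed
  \<comment> \<open>The difference of \<open>R M\<close> and \<open>S\<close> has rank at most 2,
    with range spanned by \<open>S (unit_vec M)\<close> and \<open>unit_vec M\<close>;
    \<open>c M x\<close> is the coefficient of the latter, read off at the coordinate
    \<open>M\<close>.\<close>
  define c where "c M x = x M - S x M + x M * S (unit_vec M) M" for M x
  have diff: "(\<lambda>n. R M x n - S x n) = (\<lambda>n. - x M * S (unit_vec M) n + c M x * unit_vec M n)"
    if x: "x \<in> lp p" for M x
  proof -
    have "x(M := 0) = (\<lambda>n. x n - x M * unit_vec M n)" by (auto simp: unit_vec_def)
    then have "S (x(M := 0)) = (\<lambda>n. S x n - x M * S (unit_vec M) n)"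
      by (simp add: lp_contraction_diff[OF cS x lp_scale[OF unit_vec_lp]] lp_contractionD(3)[OF cS unit_vec_lp])
    then show ?thesis using x by (auto simp: R_def c_def unit_vec_def fun_eq_iff)
  qed
  have Se: "S (unit_vec M) \<in> lp p" "norm (S (unit_vec M) M) \<le> 1" "lp_norm p (S (unit_vec M)) \<le> 1" for M
    using lp_contractionD(1,2)[OF cS unit_vec_lp, of M]
      norm_component_le_lp_norm[OF lp_contractionD(1)[OF cS unit_vec_lp] p0, of M M] by auto
  have c: "norm (c M x) \<le> 2 * norm (x M) + norm (S x M)" for M x
  proof -
    have "norm (c M x) \<le> norm (x M) + norm (S x M) + norm (x M) * norm (S (unit_vec M) M)"
      unfolding c_def
      by (rule order_trans[OF norm_triangle_ineq]) (simp add: norm_mult norm_triangle_ineq4)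
    moreover have "norm (x M) * norm (S (unit_vec M) M) \<le> norm (x M) * 1"
      using Se by (intro mult_left_mono) auto
    ultimately show ?thesis by simp
  qed
  \<comment> \<open>The shift makes every member fix a unit vector of index at least
    \<open>m\<close>.\<close>
  let ?s = "\<lambda>i. R (i + m)"
  have "limitin (sot_star p) ?s S sequentially"
  proof (rule limitin_sot_starI[OF p1 S R])
    fix x assume x: "x \<in> lp p"
    have le: "lp_norm p (\<lambda>n. R M x n - S x n) \<le> 3 * norm (x M) + norm (S x M)" for M
    proof -
      have "lp_norm p (\<lambda>n. R M x n - S x n) \<le> norm (x M) * lp_norm p (S (unit_vec M)) + norm (c M x)"
        unfolding diff[OF x]
        using lp_add(2)[OF p1 lp_scale[OF Se(1)] lp_scale[OF unit_vec_lp], of "- x M" M "c M x" M]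
          lp_norm_scale[OF Se(1) p0, of "- x M" M] lp_norm_scale[OF unit_vec_lp p0, of "c M x" M] by simp
      moreover have "norm (x M) * lp_norm p (S (unit_vec M)) \<le> norm (x M) * 1"
        using Se by (intro mult_left_mono) auto
      ultimately show ?thesis using c[of M x] by simp
    qed
    have "(\<lambda>M. 3 * norm (x M) + norm (S x M)) \<longlonglongrightarrow> 3 * 0 + 0"
      using lp_component_tendsto_0[OF x p0] lp_component_tendsto_0[OF lp_contractionD(1)[OF cS x] p0]
      by (intro tendsto_intros)
    then have lim: "(\<lambda>M. 3 * norm (x M) + norm (S x M)) \<longlonglongrightarrow> 0" by simp
    have "(\<lambda>M. lp_norm p (\<lambda>n. R M x n - S x n)) \<longlonglongrightarrow> 0"
      by (rule tendsto_sandwich[OF _ _ tendsto_const lim]) (simp_all add: le)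
    then show "(\<lambda>i. lp_norm p (\<lambda>n. R (i + m) x n - S x n)) \<longlonglongrightarrow> 0"
      by (rule LIMSEQ_ignore_initial_segment)
  next
    fix f assume f: "f \<in> lp_dual p"
    \<comment> \<open>The adjoint is again a bounded functional, so weak nullity of the unit vectors
      also covers \<open>f (S (unit_vec M))\<close>.\<close>
    have "lp_adjoint p S f \<in> lp_dual p"
      using S by (intro lp_adjoint_in_dual[OF p1 _ f]) (simp add: lp_unit_operators_def)
    from unit_vec_weakly_null[OF p this] have "(\<lambda>M. norm (f (S (unit_vec M)))) \<longlonglongrightarrow> 0"
      by (simp add: lp_adjoint_def)
    then have "(\<lambda>M. norm (f (S (unit_vec M))) + 3 * norm (f (unit_vec M))) \<longlonglongrightarrow> 0 + 3 * 0"
      using unit_vec_weakly_null[OF p f] by (intro tendsto_intros)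
    then show "(\<lambda>i. norm (f (S (unit_vec (i + m)))) + 3 * norm (f (unit_vec (i + m)))) \<longlonglongrightarrow> 0"
      using LIMSEQ_ignore_initial_segment[of _ 0 m] by fastforce
    fix i x assume x: "x \<in> lp p" "lp_norm p x \<le> 1"
    let ?M = "i + m"
    note Sx = lp_contractionD(1)[OF cS x(1)]
    have RM: "R ?M x \<in> lp p"
      using R[of ?M] x(1) by (auto simp: lp_unit_operators_iff[OF p1] intro: lp_contractionD(1))
    have xM: "norm (x ?M) \<le> 1" and SM: "norm (S x ?M) \<le> 1"
      using norm_component_le_lp_norm[OF x(1) p0, of ?M] norm_component_le_lp_norm[OF Sx p0, of ?M] x
        lp_contractionD(2)[OF cS x(1)] by auto
    have "f (R ?M x) - f (S x) = f (\<lambda>n. - x ?M * S (unit_vec ?M) n + c ?M x * unit_vec ?M n)"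
      unfolding diff[OF x(1), symmetric] by (rule lp_dual_diff[OF f RM Sx, symmetric])
    also have "\<dots> = - x ?M * f (S (unit_vec ?M)) + c ?M x * f (unit_vec ?M)"
      by (simp only: lp_dualD(2)[OF f lp_scale[OF Se(1)] lp_scale[OF unit_vec_lp]]
          lp_dualD(1)[OF f Se(1)] lp_dualD(1)[OF f unit_vec_lp])
    also have "norm \<dots> \<le> norm (x ?M) * norm (f (S (unit_vec ?M))) + norm (c ?M x) * norm (f (unit_vec ?M))"
      by (rule order_trans[OF norm_triangle_ineq]) (simp add: norm_mult)
    \<comment> \<open>On the unit ball both coordinates in the bound for \<open>c\<close> are at
      most 1, hence the factor 2 + 1.\<close>
    also have "\<dots> \<le> 1 * norm (f (S (unit_vec ?M))) + 3 * norm (f (unit_vec ?M))"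
      using xM SM c[of ?M x] by (intro add_mono mult_right_mono) auto
    finally show "norm (f (R ?M x) - f (S x)) \<le> norm (f (S (unit_vec ?M))) + 3 * norm (f (unit_vec ?M))"
      by simp
  qed
  moreover have "R (i + m) \<in>
      {T \<in> lp_unit_operators p. \<exists>M\<ge>m. lp_norm p (\<lambda>n. T (unit_vec M) n - unit_vec M n) < e}" for i
    using R e Rfix by (auto intro!: exI[of _ "i + m"])
  ultimately show "\<exists>s. (\<forall>i. s i \<in>
      {T \<in> lp_unit_operators p. \<exists>M\<ge>m. lp_norm p (\<lambda>n. T (unit_vec M) n - unit_vec M n) < e}) \<and>
      limitin (sot_star p) s S sequentially"
    by (intro exI[of _ ?s]) blast
qed

section \<open>Sparse geometric vectors\<close>

text \<open>For injective \<open>M\<close> this is the sum of \<open>r ^ j\<close> times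
  \<open>unit_vec (M j)\<close> over \<open>j\<close> in \<open>A\<close>. Giving it by coordinates
  avoids a limit when \<open>A\<close> is infinite.\<close>

definition geometric_vec :: "(nat \<Rightarrow> nat) \<Rightarrow> real \<Rightarrow> nat set \<Rightarrow> nat \<Rightarrow> complex" where
  "geometric_vec M r A = (\<lambda>n. if n \<in> M ` A then of_real (r ^ inv M n) else 0)"

lemma geometric_vec_Un:
  assumes "inj M" "A \<inter> B = {}"
  shows "geometric_vec M r (A \<union> B) = (\<lambda>n. geometric_vec M r A n + geometric_vec M r B n)"
  using assms by (auto simp: geometric_vec_def fun_eq_iff inj_def)

lemma geometric_vec_single:
  assumes "inj M"
  shows "geometric_vec M r {j} = (\<lambda>n. of_real (r ^ j) * unit_vec (M j) n)"
  using assms by (auto simp: geometric_vec_def unit_vec_def fun_eq_iff)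

lemma power_powr_commute:
  fixes r :: real
  assumes "0 \<le> r"
  shows "(r ^ j) powr p = (r powr p) ^ j"
  using assms by (induction j) (simp_all add: powr_mult)

lemma geometric_vec_lp:
  assumes "strict_mono M" "0 < r" "r < 1" "0 < p"
  shows "geometric_vec M r A \<in> lp p"
proof -
  let ?f = "\<lambda>n. norm (geometric_vec M r UNIV n) powr p"
  have inj: "inj M" using assms(1) by (rule strict_mono_imp_inj_on)
  have q: "0 \<le> r powr p" "r powr p < 1" using assms powr_less_mono2[of p r 1] by auto
  have "?f (M j) = (r powr p) ^ j" for j
    using assms inj by (simp add: geometric_vec_def norm_power power_powr_commute)
  moreover have "summable (\<lambda>j. (r powr p) ^ j)" using q by (intro summable_geometric) auto
  ultimately have "summable (\<lambda>j. ?f (M j))" by simp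
  then have "summable ?f"
    using assms(1) by (subst (asm) summable_mono_reindex) (auto simp: geometric_vec_def)
  then have "summable (\<lambda>n. norm (geometric_vec M r A n) powr p)"
    by (rule summable_comparison_test'[of _ 0]) (use assms in \<open>auto simp: geometric_vec_def\<close>)
  then show ?thesis by (simp add: lp_def)
qed

text \<open>With \<open>q = r powr p\<close>, the geometric series beyond \<open>k\<close> sums to
  \<open>q ^ Suc k / (1 - q)\<close>, which is \<open>q ^ k * C powr p\<close>. So \<open>C\<close>
  is the factor by which the tail dominates the weight \<open>r ^ k\<close>.\<close>

lemma lp_norm_geometric_vec_tail:
  assumes M: "strict_mono M" and r: "0 < r" "r < 1" and p: "0 < p" and C: "0 \<le> C"
    and rC: "r powr p / (1 - r powr p) = C powr p"
  shows "lp_norm p (geometric_vec M r {k<..}) = C * r ^ k"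
proof -
  let ?f = "\<lambda>n. norm (geometric_vec M r {k<..} n) powr p"
  let ?q = "r powr p"
  have inj: "inj M" using M by (rule strict_mono_imp_inj_on)
  have q: "0 < ?q" "?q < 1" using r p powr_less_mono2[of p r 1] by auto
  have f: "?f (M j) = (if k < j then ?q ^ j else 0)" for j
    using r p inj by (auto simp: geometric_vec_def norm_power power_powr_commute inj_def)
  have "(\<lambda>j. ?q ^ Suc k * ?q ^ j) sums (?q ^ Suc k * (1 / (1 - ?q)))"
    using q by (intro sums_mult geometric_sums) auto
  then have "(\<lambda>j. ?f (M (j + Suc k))) sums (?q ^ k * C powr p)"
    unfolding f by (simp add: power_add mult.commute mult.left_commute flip: rC)
  \<comment> \<open>The terms up to \<open>k\<close> vanish, so the shift can be undone; next, the
    coordinates outside the range of \<open>M\<close> vanish, so the sum runs over all of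
    them.\<close>
  then have "(\<lambda>j. ?f (M j)) sums (?q ^ k * C powr p)"
    by (subst (asm) sums_zero_iff_shift) (auto simp: f)
  then have "?f sums (?q ^ k * C powr p)"
    using M by (subst (asm) sums_mono_reindex) (auto simp: geometric_vec_def)
  then have "lp_norm p (geometric_vec M r {k<..}) = (?q ^ k * C powr p) powr (1 / p)"
    unfolding lp_norm_def by (simp add: sums_iff)
  also have "?q ^ k * C powr p = (C * r ^ k) powr p"
    using r C by (simp add: powr_mult power_powr_commute)
  also have "\<dots> powr (1 / p) = C * r ^ k"
    using r C p by (simp add: powr_powr)
  finally show ?thesis .
qed

text \<open>The seminorm is left abstract to serve twice: for the size of \<open>S x\<close> and for
  the displacement of \<open>x\<close> under \<open>S\<close>.\<close>

lemma seminorm_geometric_vec_le: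
  assumes M: "strict_mono M" and r: "0 < r" "r < 1" and p: "0 < p"
    and add: "\<And>x y. x \<in> lp p \<Longrightarrow> y \<in> lp p \<Longrightarrow> \<phi> (\<lambda>n. x n + y n) \<le> \<phi> x + (\<phi> y :: real)"
    and scale: "\<And>c x. x \<in> lp p \<Longrightarrow> \<phi> (\<lambda>n. c * x n) = norm c * \<phi> x"
    and "finite A"
  shows "\<phi> (geometric_vec M r A) \<le> (\<Sum>j\<in>A. r ^ j * \<phi> (unit_vec (M j)))"
  using \<open>finite A\<close>
proof (induction A rule: finite_induct)
  case empty
  show ?case using scale[OF lp_zero, of 0] by (simp add: geometric_vec_def)
next
  case (insert j A)
  have inj: "inj M" using M by (rule strict_mono_imp_inj_on)
  have "geometric_vec M r (insert j A) = (\<lambda>n. geometric_vec M r {j} n + geometric_vec M r A n)"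
    using geometric_vec_Un[OF inj, of "{j}" A] insert by simp
  then have "\<phi> (geometric_vec M r (insert j A)) \<le> \<phi> (geometric_vec M r {j}) + \<phi> (geometric_vec M r A)"
    using add[OF geometric_vec_lp[OF M r p] geometric_vec_lp[OF M r p]] by simp
  also have "\<phi> (geometric_vec M r {j}) = r ^ j * \<phi> (unit_vec (M j))"
    unfolding geometric_vec_single[OF inj] scale[OF unit_vec_lp] using r by (simp add: norm_power)
  finally show ?case using insert by simp
qed

section \<open>The invariant cone\<close>

text \<open>Once an orbit has become small it stays small, so one good time is good for
  ever.\<close>

lemma lp_contraction_funpow_antimono:
  assumes "lp_contraction p T" "x \<in> lp p" "m \<le> n"
  shows "lp_norm p ((T ^^ n) x) \<le> lp_norm p ((T ^^ m) x)"
proof -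
  have "(T ^^ n) x = (T ^^ (n - m)) ((T ^^ m) x)"
    using assms(3) by (metis comp_apply funpow_add le_add_diff_inverse2)
  then show ?thesis
    using lp_contractionD(1)[OF lp_contraction_funpow[OF assms(1)] assms(2)]
    by (simp add: lp_contractionD(2)[OF lp_contraction_funpow[OF assms(1)]])
qed

text \<open>Each further step adds the image of the first displacement under a power of
  \<open>T\<close>, which is no longer than that displacement itself.\<close>

lemma lp_contraction_funpow_displacement:
  assumes p: "1 \<le> p" and T: "lp_contraction p T" and x: "x \<in> lp p"
  shows "lp_norm p (\<lambda>i. (T ^^ n) x i - x i) \<le> real n * lp_norm p (\<lambda>i. T x i - x i)"
proof (induction n)
  case (Suc n)
  note Tx = lp_contractionD(1)[OF T x]
  note Tn = lp_contraction_funpow[OF T, of n]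
  have "(\<lambda>i. (T ^^ Suc n) x i - x i)
      = (\<lambda>i. (T ^^ n) (\<lambda>i. T x i - x i) i + ((T ^^ n) x i - x i))"
    by (simp add: lp_contraction_diff[OF Tn Tx x] funpow_swap1)
  then show ?case
    using lp_add(2)[OF p lp_contractionD(1)[OF Tn lp_diff[OF p Tx x]]
        lp_diff[OF p lp_contractionD(1)[OF Tn x] x]]
      lp_contractionD(2)[OF Tn lp_diff[OF p Tx x]] Suc
    by (simp add: algebra_simps)
qed simp

lemma sum_geometric_telescope:
  fixes r :: real
  assumes "k \<le> m"
  shows "(\<Sum>j\<in>{k<..m}. r ^ j * (1 - r)) = r ^ Suc k - r ^ Suc m"
  using assms
proof (induction m rule: dec_induct)
  case (step m)
  then have "{k<..Suc m} = insert (Suc m) {k<..m}" by auto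
  then show ?case using step by (simp add: algebra_simps)
qed simp

text \<open>
  The tail beyond \<open>k\<close> has norm \<open>7 * r ^ k\<close> and \<open>z\<close> differs from it by at most \<open>3 * r ^ k\<close>, whence the
  ratio \<open>3 / (7 - 3)\<close>.
\<close>

lemma contraction_geometric_vec_component_le:
  assumes p: "1 < p" and S: "lp_contraction p S" and M: "strict_mono M" "0 < M 0"
    and r: "0 < r" "r < 1" and rC: "r powr p / (1 - r powr p) = 7 powr p"
    and small: "\<And>j. j < k \<Longrightarrow> lp_norm p (S (unit_vec (M j))) \<le> (1 - r) * r ^ k"
    and close: "\<And>j. k < j \<Longrightarrow> lp_norm p (\<lambda>n. S (unit_vec (M j)) n - unit_vec (M j) n) \<le> 1 - r"
  defines "z \<equiv> S (geometric_vec M r UNIV)"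
  shows "norm (z 0) \<le> 3 / 4 * lp_norm p z"
proof -
  have p1: "1 \<le> p" and p0: "0 < p" using p by auto
  have inj: "inj M" using M(1) by (rule strict_mono_imp_inj_on)
  let ?v = "geometric_vec M r"
  note v = geometric_vec_lp[OF M(1) r p0]
  note Sv = lp_contractionD(1)[OF S v]
  have tail: "lp_norm p (?v {m<..}) = 7 * r ^ m" for m
    using r p0 rC by (intro lp_norm_geometric_vec_tail[OF M(1)]) auto

  have head: "lp_norm p (S (?v {..k})) \<le> 2 * r ^ k"
  proof -
    have add: "lp_norm p (S (\<lambda>n. x n + y n)) \<le> lp_norm p (S x) + lp_norm p (S y)"
      if "x \<in> lp p" "y \<in> lp p" for x y
      using that lp_add(2)[OF p1] by (simp add: lp_contractionD[OF S])
    have scale: "lp_norm p (S (\<lambda>n. c * x n)) = norm c * lp_norm p (S x)" if "x \<in> lp p" for c x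
      using that p0 by (simp add: lp_contractionD[OF S] lp_norm_scale)
    have "lp_norm p (S (?v {..k})) \<le> (\<Sum>j\<le>k. r ^ j * lp_norm p (S (unit_vec (M j))))"
      by (rule seminorm_geometric_vec_le[OF M(1) r p0 add scale]) auto
    also have "\<dots> = (\<Sum>j<k. r ^ j * lp_norm p (S (unit_vec (M j)))) + r ^ k * lp_norm p (S (unit_vec (M k)))"
      by (simp flip: lessThan_Suc_atMost)
    \<comment> \<open>The summands below \<open>k\<close> have almost died out and together give at
      most \<open>r ^ k\<close>; the summand \<open>k\<close> is in motion and has only the
      contraction bound, a second \<open>r ^ k\<close>.\<close>
    also have "\<dots> \<le> (\<Sum>j<k. r ^ j * ((1 - r) * r ^ k)) + r ^ k * 1"
      using small r lp_contractionD(2)[OF S unit_vec_lp, of "M k"]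
      by (intro add_mono sum_mono mult_left_mono) auto
    also have "(\<Sum>j<k. r ^ j * ((1 - r) * r ^ k)) = (1 - r ^ k) * r ^ k"
      using one_diff_power_eq[of r k] by (simp add: sum_distrib_left sum_distrib_right ac_simps)
    also have "\<dots> \<le> 1 * r ^ k" using r by (intro mult_right_mono) auto
    finally show ?thesis by simp
  qed

  let ?\<phi> = "\<lambda>x. lp_norm p (\<lambda>n. S x n - x n)"
  have \<phi>_add: "?\<phi> (\<lambda>n. x n + y n) \<le> ?\<phi> x + ?\<phi> y" if xy: "x \<in> lp p" "y \<in> lp p" for x y
  proof -
    have "(\<lambda>n. S (\<lambda>n. x n + y n) n - (x n + y n)) = (\<lambda>n. (S x n - x n) + (S y n - y n))"
      using lp_contractionD(4)[OF S xy] by (simp add: algebra_simps)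
    then show ?thesis
      using lp_add(2)[OF p1 lp_diff[OF p1 lp_contractionD(1)[OF S xy(1)] xy(1)]
          lp_diff[OF p1 lp_contractionD(1)[OF S xy(2)] xy(2)]] by simp
  qed
  have \<phi>_scale: "?\<phi> (\<lambda>n. c * x n) = norm c * ?\<phi> x" if x: "x \<in> lp p" for c x
    using lp_norm_scale[OF lp_diff[OF p1 lp_contractionD(1)[OF S x] x] p0, of c]
    by (simp add: lp_contractionD(3)[OF S x] right_diff_distrib)
  \<comment> \<open>The sum estimate is for finite index sets, so the tail is cut at
    \<open>m\<close> and \<open>m\<close> is then sent to infinity.\<close>
  have "?\<phi> (?v {k<..}) \<le> r ^ k + 14 * r ^ m" if m: "k \<le> m" for m
  proof -
    have "?v {k<..} = (\<lambda>n. ?v {k<..m} n + ?v {m<..} n)"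
      using geometric_vec_Un[OF inj, of "{k<..m}" "{m<..}"] m by (simp add: ivl_disj_un ivl_disj_int)
    then have "?\<phi> (?v {k<..}) \<le> ?\<phi> (?v {k<..m}) + ?\<phi> (?v {m<..})"
      using \<phi>_add[OF v v] by simp
    also have "?\<phi> (?v {k<..m}) \<le> (\<Sum>j\<in>{k<..m}. r ^ j * ?\<phi> (unit_vec (M j)))"
      by (rule seminorm_geometric_vec_le[OF M(1) r p0 \<phi>_add \<phi>_scale]) auto
    \<comment> \<open>The displacement bound \<open>1 - r\<close> makes this sum telescope, so it
      stays below \<open>r ^ k\<close> for every \<open>m\<close>.\<close>
    also have "\<dots> \<le> (\<Sum>j\<in>{k<..m}. r ^ j * (1 - r))"
      using close r by (intro sum_mono mult_left_mono) auto
    also have "\<dots> \<le> r ^ k"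
      using power_decreasing[of k "Suc k" r] zero_le_power[of r "Suc m"] r
      unfolding sum_geometric_telescope[OF m] by linarith
    also have "?\<phi> (?v {m<..}) \<le> 7 * r ^ m + 7 * r ^ m"
      using lp_norm_diff_le[OF p1 Sv v] lp_contractionD(2)[OF S v] unfolding tail[symmetric]
      by (meson add_right_mono order_trans)
    finally show ?thesis by simp
  qed
  moreover have "(\<lambda>m. r ^ k + 14 * r ^ m) \<longlonglongrightarrow> r ^ k + 14 * 0"
    using r by (intro tendsto_intros LIMSEQ_realpow_zero) auto
  ultimately have tail_moved: "?\<phi> (?v {k<..}) \<le> r ^ k"
    by (intro LIMSEQ_le_const[of _ "r ^ k"]) auto

  have "{..k} \<union> {k<..} = UNIV" "{..k} \<inter> {k<..} = {}" by auto
  then have "?v UNIV = (\<lambda>n. ?v {..k} n + ?v {k<..} n)"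
    using geometric_vec_Un[OF inj, of "{..k}" "{k<..}" r] by simp
  then have "(\<lambda>n. z n - ?v {k<..} n) = (\<lambda>n. S (?v {..k}) n + (S (?v {k<..}) n - ?v {k<..} n))"
    unfolding z_def using lp_contractionD(4)[OF S v v] by (simp add: add_diff_eq)
  then have err: "lp_norm p (\<lambda>n. z n - ?v {k<..} n) \<le> 3 * r ^ k"
    using lp_add(2)[OF p1 Sv lp_diff[OF p1 Sv v], of "{..k}" "{k<..}" "{k<..}"] head tail_moved by simp
  have z: "z \<in> lp p" unfolding z_def by (rule Sv)
  \<comment> \<open>The tail vanishes at the coordinate 0, so \<open>z 0\<close> consists of the
    error alone.\<close>
  have "M j \<noteq> 0" for j
    using M(2) strict_mono_mono[OF M(1)] by (metis monoD le0 le_zero_eq less_irrefl)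
  then have "0 \<notin> M ` {k<..}" by (metis imageE)
  then have "?v {k<..} 0 = 0" by (simp add: geometric_vec_def)
  then have "norm (z 0) \<le> 3 * r ^ k"
    using norm_component_le_lp_norm[OF lp_diff[OF p1 z v[of "{k<..}"]] p0, of 0] err by simp
  \<comment> \<open>Subtracting the error leaves a norm of at least
    \<open>4 * r ^ k\<close>.\<close>
  moreover have "7 * r ^ k \<le> lp_norm p z + 3 * r ^ k"
    using lp_norm_diff_triangle[OF p1 v z, of "{k<..}"] err lp_norm_minus_commute[of p z "?v {k<..}"]
    by (simp add: tail)
  ultimately show ?thesis by simp
qed

text \<open>Imposing the inequality on whole orbits makes the set invariant; homogeneity makes it a
  cone, and continuity of the iterates makes it closed.\<close>

lemma nontrivial_invariant_closed_coneI:
  assumes p: "1 < p" and T: "lp_contraction p T" and x: "x \<in> lp p" "x \<noteq> (\<lambda>n. 0)"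
    and orbit: "\<And>n. norm ((T ^^ n) x 0) \<le> 3 / 4 * lp_norm p ((T ^^ n) x)"
  shows "\<exists>C. nontrivial_invariant_closed_cone p T C"
proof
  have p1: "1 \<le> p" and p0: "0 < p" using p by auto
  interpret M: Metric_space "lp p" "lp_dist p" by (rule Metric_space_lp[OF p1])
  define C where "C = {z \<in> lp p. \<forall>n. norm ((T ^^ n) z 0) \<le> 3 / 4 * lp_norm p ((T ^^ n) z)}"
  note Tn = lp_contraction_funpow[OF T]
  have xC: "x \<in> C" using x orbit by (simp add: C_def)
  have "closedin (lp_topology p) C"
    unfolding lp_topology_def M.closedin_metric
  proof (intro conjI allI impI)
    show "C \<subseteq> lp p" by (auto simp: C_def)
    fix z assume z: "z \<in> lp p - C"
    then obtain n where n: "norm ((T ^^ n) z 0) > 3 / 4 * lp_norm p ((T ^^ n) z)"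
      by (auto simp: C_def not_le)
    have zl: "z \<in> lp p" using z by simp
    \<comment> \<open>The excess at time \<open>n\<close>. Moving \<open>z\<close> by less than
      \<open>d / 2\<close> changes the two sides by less than \<open>d / 2\<close> and
      \<open>3 / 8 * d\<close>, so it stays positive.\<close>
    define d where "d = norm ((T ^^ n) z 0) - 3 / 4 * lp_norm p ((T ^^ n) z)"
    have "y \<notin> C" if y: "y \<in> M.mball z (d / 2)" for y
    proof
      assume "y \<in> C"
      then have yl: "y \<in> lp p" and yn: "norm ((T ^^ n) y 0) \<le> 3 / 4 * lp_norm p ((T ^^ n) y)"
        by (auto simp: C_def)
      let ?u = "\<lambda>i. (T ^^ n) z i - (T ^^ n) y i"
      have u: "?u = (T ^^ n) (\<lambda>i. z i - y i)"
        by (rule lp_contraction_diff[OF Tn zl yl, symmetric])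
      have ud: "lp_norm p ?u < d / 2"
        unfolding u using lp_contractionD(2)[OF Tn lp_diff[OF p1 zl yl], of n] y
        by (simp add: lp_dist_def)
      note mem = lp_contractionD(1)[OF Tn zl, of n] lp_contractionD(1)[OF Tn yl, of n]
      have "norm ((T ^^ n) z 0) \<le> norm ((T ^^ n) y 0) + lp_norm p ?u"
        using norm_component_le_lp_norm[OF lp_diff[OF p1 mem] p0, of 0]
          norm_triangle_sub[of "(T ^^ n) z 0" "(T ^^ n) y 0"] by linarith
      moreover have "lp_norm p ((T ^^ n) y) \<le> lp_norm p ((T ^^ n) z) + lp_norm p ?u"
        using lp_norm_diff_triangle[OF p1 mem(2,1)] by (simp add: lp_norm_minus_commute[of p "(T ^^ n) y"])
      ultimately show False using n yn ud unfolding d_def by (simp add: field_simps)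
    qed
    then show "\<exists>e>0. disjnt C (M.mball z e)"
      using n by (intro exI[of _ "d / 2"]) (auto simp: disjnt_def d_def)
  qed
  moreover have "(\<lambda>n. complex_of_real t * z n) \<in> C" if t: "t \<ge> 0" and z: "z \<in> C" for t z
  proof -
    have zl: "z \<in> lp p" using z by (simp add: C_def)
    have "(T ^^ n) (\<lambda>i. complex_of_real t * z i) = (\<lambda>i. complex_of_real t * (T ^^ n) z i)" for n
      by (rule lp_contractionD(3)[OF Tn zl])
    moreover have "t * norm ((T ^^ n) z 0) \<le> t * (3 / 4 * lp_norm p ((T ^^ n) z))" for n
      using z by (intro mult_left_mono t) (simp add: C_def)
    ultimately show ?thesis
      using t p0 zl
      by (simp add: C_def lp_scale lp_norm_scale lp_contractionD(1)[OF Tn] norm_mult mult.left_commute)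
  qed
  moreover have "T ` C \<subseteq> C"
  proof safe
    fix z assume z: "z \<in> C"
    have "(T ^^ n) (T z) = (T ^^ Suc n) z" for n by (simp add: funpow_swap1)
    with z show "T z \<in> C"
      unfolding C_def mem_Collect_eq by (metis lp_contractionD(1)[OF T])
  qed
  \<comment> \<open>At time 0 its coordinate 0 equals its norm, so the cone is not the whole
    space.\<close>
  moreover have "unit_vec 0 \<notin> C"
  proof
    assume "unit_vec 0 \<in> C"
    then have "norm ((T ^^ 0) (unit_vec 0) 0) \<le> 3 / 4 * lp_norm p ((T ^^ 0) (unit_vec 0))"
      unfolding C_def by blast
    then show False by simp (simp add: unit_vec_def)
  qed
  ultimately show "nontrivial_invariant_closed_cone p T C"
    unfolding nontrivial_invariant_closed_cone_def using xC x(2) by (auto intro: unit_vec_lp)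
qed

section \<open>Choice of the ratio, the indices and the times\<close>

lemma contraction_has_invariant_cone:
  assumes p: "1 < p" and T: "lp_contraction p T"
    and fixed: "\<And>m e. e > 0 \<Longrightarrow> \<exists>M\<ge>m. lp_norm p (\<lambda>n. T (unit_vec M) n - unit_vec M n) < e"
    and null: "\<And>j e. e > 0 \<Longrightarrow> \<exists>n. lp_norm p ((T ^^ n) (unit_vec j)) < e"
  shows "\<exists>C. nontrivial_invariant_closed_cone p T C"
proof -
  have p1: "1 \<le> p" and p0: "0 < p" using p by auto
  \<comment> \<open>The solution of \<open>q / (1 - q) = 7 powr p\<close>, so that a tail has 7
    times the weight preceding it.\<close>
  define q :: real where "q = 7 powr p / (1 + 7 powr p)"
  define r where "r = q powr (1 / p)"
  have pos: "(7::real) powr p > 0" by simp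
  have q: "0 < q" "q < 1"
    using pos by (auto simp: q_def add_pos_pos)
  have nz: "1 + (7::real) powr p \<noteq> 0" using pos by linarith
  then have "1 - q = 1 / (1 + 7 powr p)" by (simp add: q_def divide_simps)
  then have q': "q / (1 - q) = 7 powr p" using nz by (simp add: q_def)
  have r: "0 < r" "r < 1" using q p0 powr_less_mono2[of "1 / p" q 1] by (auto simp: r_def)
  have rq: "r powr p = q" using q p0 by (simp add: r_def powr_powr)
  have null': "\<exists>N. \<forall>n\<ge>N. \<forall>i\<le>m. lp_norm p ((T ^^ n) (unit_vec i)) \<le> e" if e: "e > 0" for m e
  proof -
    obtain \<nu> where \<nu>: "\<And>i. lp_norm p ((T ^^ \<nu> i) (unit_vec i)) < e"
      using null[OF e] by metis
    \<comment> \<open>The sum of the individual times is a common upper bound for them.\<close>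
    have "lp_norm p ((T ^^ n) (unit_vec i)) \<le> e" if "n \<ge> (\<Sum>j\<le>m. \<nu> j)" "i \<le> m" for n i
    proof -
      have "\<nu> i \<le> (\<Sum>j\<le>m. \<nu> j)" using that by (intro member_le_sum) auto
      then show ?thesis
        using lp_contraction_funpow_antimono[OF T unit_vec_lp, of "\<nu> i" n i] \<nu>[of i] that by simp
    qed
    then show ?thesis by blast
  qed
  have fixed': "\<exists>M>m. \<forall>n\<le>N. lp_norm p (\<lambda>i. (T ^^ n) (unit_vec M) i - unit_vec M i) \<le> 1 - r" for m N
  proof -
    obtain M where M: "M \<ge> Suc m" "lp_norm p (\<lambda>n. T (unit_vec M) n - unit_vec M n) < (1 - r) / real (Suc N)"
      using fixed[of "(1 - r) / real (Suc N)" "Suc m"] r by auto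
    have "lp_norm p (\<lambda>i. (T ^^ n) (unit_vec M) i - unit_vec M i) \<le> 1 - r" if "n \<le> N" for n
    proof -
      have "lp_norm p (\<lambda>i. (T ^^ n) (unit_vec M) i - unit_vec M i)
          \<le> real n * lp_norm p (\<lambda>n. T (unit_vec M) n - unit_vec M n)"
        by (rule lp_contraction_funpow_displacement[OF p1 T unit_vec_lp])
      also have "\<dots> \<le> real (Suc N) * ((1 - r) / real (Suc N))"
        using M(2) that by (intro mult_mono) auto
      finally show ?thesis by simp
    qed
    then show ?thesis using M(1) by (intro exI[of _ M]) auto
  qed
  \<comment> \<open>A state is a pair of index and time. The exponent is \<open>Suc k\<close>
    because the decay reached at stage \<open>k\<close> is used from stage \<open>Suc k\<close>
    on.\<close>
  define P where "P k s \<longleftrightarrow> 0 < fst s \<and>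
      (\<forall>n\<ge>snd s. \<forall>i\<le>fst s. lp_norm p ((T ^^ n) (unit_vec i)) \<le> (1 - r) * r ^ Suc k)" for k and s :: "nat \<times> nat"
  \<comment> \<open>The next index is chosen after the current time, so that its unit vector has
    hardly moved until then.\<close>
  define Q where "Q s t \<longleftrightarrow> fst s < fst t \<and> snd s < snd t \<and>
      (\<forall>n\<le>snd s. lp_norm p (\<lambda>i. (T ^^ n) (unit_vec (fst t)) i - unit_vec (fst t) i) \<le> 1 - r)"
    for s t :: "nat \<times> nat"
  have epos: "(1 - r) * r ^ k > 0" for k using r by simp
  obtain f where f: "\<And>k. P k (f k)" "\<And>k. Q (f k) (f (Suc k))"
  proof (rule exE[OF dependent_nat_choice[of P "\<lambda>_. Q"]])
    obtain N where "\<forall>n\<ge>N. \<forall>i\<le>1. lp_norm p ((T ^^ n) (unit_vec i)) \<le> (1 - r) * r ^ Suc 0"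
      using null'[OF epos] by blast
    \<comment> \<open>Starting at index 1 keeps the coordinate 0 out of the support.\<close>
    then have "P 0 (1, N)" by (simp add: P_def)
    then show "\<exists>s. P 0 s" by blast
    fix s k assume "P k s"
    obtain m where m: "m > fst s"
      "\<forall>n\<le>snd s. lp_norm p (\<lambda>i. (T ^^ n) (unit_vec m) i - unit_vec m i) \<le> 1 - r"
      using fixed' by blast
    obtain N where "\<forall>n\<ge>N. \<forall>i\<le>m. lp_norm p ((T ^^ n) (unit_vec i)) \<le> (1 - r) * r ^ Suc (Suc k)"
      using null'[OF epos] by blast
    then have "P (Suc k) (m, N + Suc (snd s)) \<and> Q s (m, N + Suc (snd s))"
      using m by (auto simp: P_def Q_def)
    then show "\<exists>t. P (Suc k) t \<and> Q s t" by blast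
  qed blast
  define M where "M k = fst (f k)" for k
  define N where "N k = snd (f k)" for k
  have M: "strict_mono M" and N: "strict_mono N"
    using f(2) by (auto simp: M_def N_def Q_def strict_mono_Suc_iff)
  have M0: "0 < M 0" using f(1)[of 0] by (simp add: P_def M_def)
  let ?x = "geometric_vec M r UNIV"
  have "norm ((T ^^ n) ?x 0) \<le> 3 / 4 * lp_norm p ((T ^^ n) ?x)" for n
  proof -
    \<comment> \<open>The stage of time \<open>n\<close>: the time of the preceding stage has
      passed, so earlier unit vectors are small, while \<open>N k\<close> has not, so later ones are
      still in place.\<close>
    define k where "k = (LEAST k. n \<le> N k)"
    have "n \<le> N n" using N by (rule strict_mono_imp_increasing)
    then have nk: "n \<le> N k" unfolding k_def by (rule LeastI)
    have small: "lp_norm p ((T ^^ n) (unit_vec (M j))) \<le> (1 - r) * r ^ k" if j: "j < k" for j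
    proof -
      obtain l where l: "k = Suc l" using j by (cases k) auto
      then have "N l \<le> n" using not_less_Least[of l "\<lambda>k. n \<le> N k"] by (simp add: k_def)
      moreover have "M j \<le> M l" using monoD[OF strict_mono_mono[OF M], of j l] j l by simp
      moreover have "\<forall>n\<ge>N l. \<forall>i\<le>M l. lp_norm p ((T ^^ n) (unit_vec i)) \<le> (1 - r) * r ^ k"
        using f(1)[of l] unfolding P_def M_def N_def l by blast
      ultimately show ?thesis by blast
    qed
    have close: "lp_norm p (\<lambda>i. (T ^^ n) (unit_vec (M j)) i - unit_vec (M j) i) \<le> 1 - r" if j: "k < j" for j
    proof -
      obtain l where l: "j = Suc l" using j by (cases j) auto
      then have "n \<le> N l" using nk j monoD[OF strict_mono_mono[OF N], of k l] by simp
      then show ?thesis using f(2)[of l] unfolding Q_def M_def N_def l by blast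
    qed
    show ?thesis
      using q' by (intro contraction_geometric_vec_component_le[OF p lp_contraction_funpow[OF T] M M0 r _ small close])
        (auto simp: rq)
  qed
  moreover have "?x (M 0) \<noteq> 0"
    using M by (simp add: geometric_vec_def strict_mono_imp_inj_on)
  then have "?x \<noteq> (\<lambda>n. 0)" by metis
  ultimately show ?thesis
    by (intro nontrivial_invariant_closed_coneI[OF p T geometric_vec_lp[OF M r p0]])
qed

section \<open>Baire category argument\<close>

theorem corollary7p4:
  fixes p :: real
  assumes "1 < p"
  shows "comeager_in (sot_star p)
           {T \<in> lp_unit_operators p. \<exists>C. nontrivial_invariant_closed_cone p T C}"
proof -
  have p1: "1 \<le> p" using assms by simp
  \<comment> \<open>Tolerances \<open>inverse (real (Suc k))\<close> suffice to reach every positive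
    \<open>e\<close> and keep the family of open sets countable.\<close>
  define F where "F m k = {T \<in> lp_unit_operators p.
    \<exists>M\<ge>m. lp_norm p (\<lambda>n. T (unit_vec M) n - unit_vec M n) < inverse (real (Suc k))}" for m k
  define Z where "Z j k = {T \<in> lp_unit_operators p.
    \<exists>n. lp_norm p ((T ^^ n) (unit_vec j)) < inverse (real (Suc k))}" for j k
  \<comment> \<open>Writing \<open>T\<close> as \<open>T ^^ 1\<close> exhibits the set as a union of
    preimages of balls under orbit maps; for \<open>Z\<close> the balls are centred at 0.\<close>
  have "F m k = (\<Union>M\<in>{m..}. {T \<in> lp_unit_operators p.
      lp_norm p (\<lambda>n. (T ^^ 1) (unit_vec M) n - unit_vec M n) < inverse (real (Suc k))})" for m k
    by (auto simp: F_def)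
  then have openF: "openin (sot_star p) (F m k)" for m k
    using openin_sot_star_funpow_ball[OF p1 unit_vec_lp unit_vec_lp, where n = 1] by (auto simp del: One_nat_def intro!: openin_Union)
  have "Z j k = (\<Union>n. {T \<in> lp_unit_operators p.
      lp_norm p (\<lambda>i. (T ^^ n) (unit_vec j) i - 0) < inverse (real (Suc k))})" for j k
    by (auto simp: Z_def)
  then have openZ: "openin (sot_star p) (Z j k)" for j k
    using openin_sot_star_funpow_ball[OF p1 unit_vec_lp lp_zero] by (auto intro!: openin_Union)
  have denseF: "sot_star p closure_of F m k = topspace (sot_star p)" for m k
    unfolding F_def by (intro dense_almost_fixed[OF assms]) simp
  have denseZ: "sot_star p closure_of Z j k = topspace (sot_star p)" for j k
    unfolding Z_def by (intro dense_strongly_null[OF assms]) simp_all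
  show ?thesis
  proof (rule comeager_in_supset_Inter)
    show "countable (range (case_prod F) \<union> range (case_prod Z))" by simp
    show "openin (sot_star p) U" "sot_star p closure_of U = topspace (sot_star p)"
      if "U \<in> range (case_prod F) \<union> range (case_prod Z)" for U
      using that openF openZ denseF denseZ by auto
    show "{T \<in> lp_unit_operators p. \<exists>C. nontrivial_invariant_closed_cone p T C} \<subseteq> topspace (sot_star p)"
      by (auto simp: topspace_sot_star[OF p1])
    show "topspace (sot_star p) \<inter> \<Inter>(range (case_prod F) \<union> range (case_prod Z))
        \<subseteq> {T \<in> lp_unit_operators p. \<exists>C. nontrivial_invariant_closed_cone p T C}"
    proof
      fix T assume "T \<in> topspace (sot_star p) \<inter> \<Inter>(range (case_prod F) \<union> range (case_prod Z))"
      then have T: "T \<in> lp_unit_operators p" and TF: "\<And>m k. T \<in> F m k" and TZ: "\<And>j k. T \<in> Z j k"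
        by (auto simp: topspace_sot_star[OF p1])
      have "\<exists>C. nontrivial_invariant_closed_cone p T C"
      proof (rule contraction_has_invariant_cone[OF assms])
        show "lp_contraction p T" using T by (simp add: lp_unit_operators_iff[OF p1])
        fix m :: nat and e :: real assume "e > 0"
        then obtain k where k: "inverse (real (Suc k)) < e" using reals_Archimedean by blast
        show "\<exists>M\<ge>m. lp_norm p (\<lambda>n. T (unit_vec M) n - unit_vec M n) < e"
          using TF[of m k] k unfolding F_def by (auto intro: less_trans)
        show "\<exists>n. lp_norm p ((T ^^ n) (unit_vec m)) < e"
          using TZ[of m k] k unfolding Z_def by (auto intro: less_trans)
      qed
      with T show "T \<in> {T \<in> lp_unit_operators p. \<exists>C. nontrivial_invariant_closed_cone p T C}" by simp
    qed
  qed
qed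

end
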